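(* Let $d\ge1$, $T>0$, $\alpha\in(0,2)$, and let $\{L_t\}_{t\in[0,T]}$ be a $d$-dimensional symmetric rotationally invariant $\alpha$-stable process with $L_0=0$ on a filtered probability space $(\Omega,\mathcal F,\{\mathcal F_t\}_{t\in[0,T]},\mathbb P)$ satisfying the usual hypotheses. Let $\beta\in(\max\{0,1-\alpha\},1)$ and $p\in[1,\infty)$. If $p<\alpha/(\alpha+\beta-1)$, then there exist an initial condition $x\in\mathbb{R}^d$ and a drift $b\in L^p([0,T];\mathcal{C}_b^\beta(\mathbb{R}^d;\mathbb{R}^d))$ such that there exist two distinct solutions to the SDE $$X_t=x+\int_0^t b(s,X_s)\,ds+L_t,\qquad t\in[0,T].$$
   Context: For $\beta\in(0,1)$, $\mathcal{C}_b^\beta(\mathbb{R}^d)$ is the space of bounded $\beta$-Hölder continuous functions with norm $\|h\|_\beta=\|h\|_0+[h]_\beta$, where $\|h\|_0=\sup_x|h(x)|$ and $[h]_\beta=\sup_{x\ne y}|h(x)-h(y)|/|x-y|^\beta$. $L^p([0,T];\mathcal{C}_b^\beta(\mathbb{R}^d;\mathbb{R}^d))$ is the space of Borel functions $b:[0,T]\times\mathbb{R}^d\to\mathbb{R}^d$ that are $L^p$ in time with values in $\mathcal{C}_b^\beta$ (coordinate-wise), i.e. $\int_0^T\|b(t,\cdot)\|_0^p\,dt+\int_0^T[b(t,\cdot)]_\beta^p\,dt<\infty$. A symmetric rotationally invariant $\alpha$-stable process is the Lévy process (with respect to the given filtration, with càdlàg paths) whose generator is the fractional Laplacian $\Delta^{\alpha/2}=-(-\Delta)^{\alpha/2}$;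 its Lévy measure is $\nu(dz)=c(d,\alpha)|z|^{-d-\alpha}dz$, with no drift and no Gaussian part. A solution here is an $\{\mathcal F_t\}$-adapted càdlàg process $X$ on the given filtered probability space satisfying the equation $\mathbb P$-a.s. for all $t\in[0,T]$ with the given process $L$; two solutions are distinct if they are not indistinguishable (so pathwise uniqueness fails). *)

theory Defs
  imports "HOL-Probability.Probability"
begin

section \<open>Hoelder spaces\<close>

definition sup_norm :: "('a \<Rightarrow> 'b::real_normed_vector) \<Rightarrow> real" where
  "sup_norm h = (SUP x. norm (h x))"

definition holder_quotients ::
  "real \<Rightarrow> ('a::real_normed_vector \<Rightarrow> 'b::real_normed_vector) \<Rightarrow> real set" where
  "holder_quotients \<beta> h = {norm (h x - h y) / norm (x - y) powr \<beta> | x y. x \<noteq> y}"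

definition holder_seminorm ::
  "real \<Rightarrow> ('a::real_normed_vector \<Rightarrow> 'b::real_normed_vector) \<Rightarrow> real" where
  "holder_seminorm \<beta> h = Sup (holder_quotients \<beta> h)"

definition holder_space ::
  "real \<Rightarrow> ('a::real_normed_vector \<Rightarrow> 'b::real_normed_vector) set" where
  "holder_space \<beta> = {h. bounded (range h) \<and> bdd_above (holder_quotients \<beta> h)}"

text \<open>Every \<open>b t\<close> with \<open>0 \<le> t \<le> T\<close> is required to lie in the Hoelder space, so that the
  real-valued suprema in the two integrals are genuine ones. Values of \<open>b\<close> at times outside
  \<open>[0,T]\<close> are irrelevant.\<close>

definition Lp_holder ::
  "real \<Rightarrow> real \<Rightarrow> real \<Rightarrow> (real \<Rightarrow> 'a::euclidean_space \<Rightarrow> 'b::euclidean_space) set" where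
  "Lp_holder T p \<beta> = {b.
     (\<lambda>(t, x). b t x) \<in> borel_measurable (restrict_space borel ({0..T} \<times> UNIV)) \<and>
     (\<forall>t\<in>{0..T}. b t \<in> holder_space \<beta>) \<and>
     (\<integral>\<^sup>+t\<in>{0..T}. ennreal (sup_norm (b t) powr p) \<partial>lborel)
       + (\<integral>\<^sup>+t\<in>{0..T}. ennreal (holder_seminorm \<beta> (b t) powr p) \<partial>lborel) < \<infinity>}"


section \<open>Filtered probability spaces on a finite time interval\<close>

definition filtration_on :: "real \<Rightarrow> 'w measure \<Rightarrow> (real \<Rightarrow> 'w measure) \<Rightarrow> bool" where
  "filtration_on T M F \<longleftrightarrow>
     (\<forall>t\<in>{0..T}. subalgebra M (F t)) \<and>
     (\<forall>s\<in>{0..T}. \<forall>t\<in>{0..T}. s \<le> t \<longrightarrow> sets (F s) \<subseteq> sets (F t))"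

definition usual_hypotheses :: "real \<Rightarrow> 'w measure \<Rightarrow> (real \<Rightarrow> 'w measure) \<Rightarrow> bool" where
  "usual_hypotheses T M F \<longleftrightarrow>
     complete_measure M \<and> null_sets M \<subseteq> sets (F 0) \<and>
     (\<forall>t\<in>{0..<T}. sets (F t) = (\<Inter>s\<in>{t<..T}. sets (F s)))"

definition adapted_on ::
  "real \<Rightarrow> (real \<Rightarrow> 'w measure) \<Rightarrow> (real \<Rightarrow> 'w \<Rightarrow> 'a::euclidean_space) \<Rightarrow> bool" where
  "adapted_on T F X \<longleftrightarrow> (\<forall>t\<in>{0..T}. X t \<in> borel_measurable (F t))"

definition cadlag_on :: "real \<Rightarrow> (real \<Rightarrow> 'a::topological_space) \<Rightarrow> bool" where
  "cadlag_on T f \<longleftrightarrow>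
     (\<forall>t\<in>{0..<T}. (f \<longlongrightarrow> f t) (at_right t)) \<and>
     (\<forall>t\<in>{0<..T}. \<exists>l. (f \<longlongrightarrow> l) (at_left t))"


section \<open>Levy processes\<close>

text \<open>Stochastic continuity is not listed, as it follows from stationarity of the increments
  and right-continuity of the paths.\<close>

definition levy_process ::
  "real \<Rightarrow> 'w measure \<Rightarrow> (real \<Rightarrow> 'w measure) \<Rightarrow> (real \<Rightarrow> 'w \<Rightarrow> 'a::euclidean_space) \<Rightarrow> bool" where
  "levy_process T M F L \<longleftrightarrow>
     adapted_on T F L \<and>
     (\<forall>\<omega>\<in>space M. cadlag_on T (\<lambda>t. L t \<omega>)) \<and>
     (AE \<omega> in M. L 0 \<omega> = 0) \<and>
     (\<forall>s\<in>{0..T}. \<forall>t\<in>{s..T}. prob_space.indep_set M (sets (F s))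
        (sets (vimage_algebra (space M) (\<lambda>\<omega>. L t \<omega> - L s \<omega>) borel))) \<and>
     (\<forall>s\<in>{0..T}. \<forall>t\<in>{s..T}.
        distr M borel (\<lambda>\<omega>. L t \<omega> - L s \<omega>) = distr M borel (L (t - s)))"

text \<open>The Levy--Khintchine exponent with drift \<open>a\<close>, Gaussian covariance \<open>Q\<close> and Levy measure
  \<open>\<nu>\<close>, with truncation at the closed unit ball.\<close>

definition levy_exponent ::
  "real ^ 'n \<Rightarrow> real ^ 'n ^ 'n \<Rightarrow> (real ^ 'n) measure \<Rightarrow> real ^ 'n \<Rightarrow> complex" where
  "levy_exponent a Q \<nu> \<xi> =
     \<i> * of_real (a \<bullet> \<xi>) - of_real (\<xi> \<bullet> (Q *v \<xi>)) / 2
     + (\<integral>z. (cis (\<xi> \<bullet> z) - 1 - \<i> * of_real (\<xi> \<bullet> z) * indicator (cball 0 1) z) \<partial>\<nu>)"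

definition has_levy_triplet ::
  "real \<Rightarrow> 'w measure \<Rightarrow> (real \<Rightarrow> 'w \<Rightarrow> real ^ 'n) \<Rightarrow>
   real ^ 'n \<Rightarrow> real ^ 'n ^ 'n \<Rightarrow> (real ^ 'n) measure \<Rightarrow> bool" where
  "has_levy_triplet T M L a Q \<nu> \<longleftrightarrow>
     (\<forall>t\<in>{0..T}. \<forall>\<xi>. (\<integral>\<omega>. cis (\<xi> \<bullet> L t \<omega>) \<partial>M) = exp (of_real t * levy_exponent a Q \<nu> \<xi>))"

text \<open>The constant \<open>c(d,\<alpha>)\<close> for which the principal-value operator
  \<open>f \<mapsto> c(d,\<alpha>) PV\<integral> (f (x + z) - f x) |z|\<^sup>-\<^sup>d\<^sup>-\<^sup>\<alpha> dz\<close> is the fractional Laplacian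
  \<open>-(-\<Delta>)\<^sup>\<alpha>\<^sup>/\<^sup>2\<close>, the Fourier multiplier with symbol \<open>-|\<xi>|\<^sup>\<alpha>\<close>.\<close>

definition frac_laplacian_const :: "nat \<Rightarrow> real \<Rightarrow> real" where
  "frac_laplacian_const d \<alpha> =
     2 powr \<alpha> * Gamma ((real d + \<alpha>) / 2) / (pi powr (real d / 2) * \<bar>Gamma (- \<alpha> / 2)\<bar>)"

definition stable_levy_measure :: "real \<Rightarrow> (real ^ 'n) measure" where
  "stable_levy_measure \<alpha> = density lborel (\<lambda>z.
     ennreal (frac_laplacian_const CARD('n) \<alpha> * norm z powr (- real CARD('n) - \<alpha>)))"

text \<open>The process whose generator is \<open>-(-\<Delta>)\<^sup>\<alpha>\<^sup>/\<^sup>2\<close>; the generator is specified through its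
  Levy triplet.\<close>

definition rot_inv_stable_process ::
  "real \<Rightarrow> real \<Rightarrow> 'w measure \<Rightarrow> (real \<Rightarrow> 'w measure) \<Rightarrow> (real \<Rightarrow> 'w \<Rightarrow> real ^ 'n) \<Rightarrow> bool" where
  "rot_inv_stable_process \<alpha> T M F L \<longleftrightarrow>
     levy_process T M F L \<and> has_levy_triplet T M L 0 0 (stable_levy_measure \<alpha>)"


section \<open>Solutions of the equation\<close>

definition sde_solution ::
  "real \<Rightarrow> 'w measure \<Rightarrow> (real \<Rightarrow> 'w measure) \<Rightarrow> (real \<Rightarrow> 'w \<Rightarrow> 'a::euclidean_space) \<Rightarrow>
   'a \<Rightarrow> (real \<Rightarrow> 'a \<Rightarrow> 'a) \<Rightarrow> (real \<Rightarrow> 'w \<Rightarrow> 'a) \<Rightarrow> bool" where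
  "sde_solution T M F L x b X \<longleftrightarrow>
     adapted_on T F X \<and>
     (\<forall>\<omega>\<in>space M. cadlag_on T (\<lambda>t. X t \<omega>)) \<and>
     (AE \<omega> in M.
        set_integrable lborel {0..T} (\<lambda>s. b s (X s \<omega>)) \<and>
        (\<forall>t\<in>{0..T}. X t \<omega> = x + (LINT s:{0..t}|lborel. b s (X s \<omega>)) + L t \<omega>))"

definition indistinguishable_on ::
  "real \<Rightarrow> 'w measure \<Rightarrow> (real \<Rightarrow> 'w \<Rightarrow> 'a) \<Rightarrow> (real \<Rightarrow> 'w \<Rightarrow> 'a) \<Rightarrow> bool" where
  "indistinguishable_on T M X Y \<longleftrightarrow> (AE \<omega> in M. \<forall>t\<in>{0..T}. X t \<omega> = Y t \<omega>)"

end

theory Submission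
  imports Defs
begin

text \<open>
  Fix a unit vector \<open>e\<close>. The drift is \<open>b t x = t\<^sup>-\<^sup>\<gamma> sgn(e \<bullet> x) (\<bar>e \<bullet> x\<bar> \<and> 1)\<^sup>\<beta> e\<close> with
  \<open>(\<alpha> + \<beta> - 1) / \<alpha> < \<gamma> < 1 / p\<close>. The upper bound on \<open>\<gamma>\<close> gives integrability in time. Without
  noise, the equation started at \<open>0\<close> has the two solutions \<open>\<plusminus> const t\<^sup>\<kappa> e\<close> with
  \<open>\<kappa> = (1 - \<gamma>) / (1 - \<beta>)\<close>, and the lower bound on \<open>\<gamma>\<close> says that \<open>\<kappa> < 1 / \<alpha>\<close>, so that the noise,
  of size \<open>t\<^sup>1\<^sup>/\<^sup>\<alpha>\<close> at time \<open>t\<close>, is too weak near \<open>t = 0\<close> to reconnect these two branches.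

  Since \<open>b\<close> is nondecreasing along \<open>e\<close>, the maximal and the minimal solution are pathwise limits of a
  monotone Picard iteration, hence adapted. The smallness of the noise, \<open>\<bar>e \<bullet> L\<^sub>t\<bar> \<le> \<epsilon> t\<^sup>\<kappa>\<close> near \<open>0\<close>
  almost surely, follows from the tail estimate \<open>P(\<bar>e \<bullet> L\<^sub>t\<bar> > x) \<le> C t x\<^sup>-\<^sup>\<alpha>\<close> on characteristic
  functions, Ottaviani's inequality and the Borel-Cantelli lemma along dyadic times.
\<close>

section \<open>The monotone iteration\<close>

lemma powr_diff_le:
  fixes a b \<beta> :: real
  assumes "0 \<le> a" "a \<le> b" "0 < \<beta>" "\<beta> \<le> 1"
  shows "b powr \<beta> - a powr \<beta> \<le> (b - a) powr \<beta>"
proof (cases "b = 0")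
  case False
  then have b: "b > 0" using assms by simp
  \<comment> \<open>A number in [0,1] is at most its power with exponent \<beta> \<le> 1. Adding
    this for the fractions \<open>a / b\<close> and \<open>(b - a) / b\<close>, which sum to 1,
    gives subadditivity of the power.\<close>
  have *: "x / b \<le> x powr \<beta> / b powr \<beta>" if "0 \<le> x" "x \<le> b" for x
    using powr_mono'[of \<beta> 1 "x / b"] that b assms by (simp add: powr_divide)
  have "1 \<le> a powr \<beta> / b powr \<beta> + (b - a) powr \<beta> / b powr \<beta>"
    using *[of a] *[of "b - a"] assms b by (simp add: diff_divide_distrib)
  then have "1 \<le> (a powr \<beta> + (b - a) powr \<beta>) / b powr \<beta>"
    by (simp add: add_divide_distrib)
  then have "b powr \<beta> \<le> a powr \<beta> + (b - a) powr \<beta>"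
    using b by (simp add: pos_le_divide_eq)
  then show ?thesis by simp
qed (use assms in auto)

lemma powr_abs_diff_le:
  fixes a b \<beta> :: real
  assumes "0 \<le> a" "0 \<le> b" "0 < \<beta>" "\<beta> \<le> 1"
  shows "\<bar>b powr \<beta> - a powr \<beta>\<bar> \<le> \<bar>b - a\<bar> powr \<beta>"
proof (cases "a \<le> b")
  case True
  then show ?thesis
    using powr_diff_le[OF assms(1) True assms(3,4)] powr_mono2[of \<beta> a b] assms by auto
next
  case False
  then show ?thesis
    using powr_diff_le[of b a \<beta>] powr_mono2[of \<beta> b a] assms
    by (auto simp: abs_minus_commute[of b a])
qed

text \<open>This is sgn(x) times the \<beta>-th power of min(|x|, 1), written through the positive
  and the negative part. As \<open>0 powr \<beta> = 0\<close>, only one term is active at a time,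
  and no case split on the sign is needed.\<close>

definition signed_powr :: "real \<Rightarrow> real \<Rightarrow> real" where
  "signed_powr \<beta> x = min (max x 0) 1 powr \<beta> - min (max (-x) 0) 1 powr \<beta>"

lemma signed_powr_minus: "signed_powr \<beta> (- x) = - signed_powr \<beta> x"
  by (simp add: signed_powr_def)

lemma signed_powr_pos: "0 < x \<Longrightarrow> x \<le> 1 \<Longrightarrow> signed_powr \<beta> x = x powr \<beta>"
  by (simp add: signed_powr_def)

lemma signed_powr_mono: "0 < \<beta> \<Longrightarrow> x \<le> y \<Longrightarrow> signed_powr \<beta> x \<le> signed_powr \<beta> y"
  unfolding signed_powr_def by (intro diff_mono powr_mono2) auto

lemma abs_signed_powr_le_1: "0 < \<beta> \<Longrightarrow> \<bar>signed_powr \<beta> x\<bar> \<le> 1"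
  using powr_mono2[of \<beta> "min (max x 0) 1" 1] powr_mono2[of \<beta> "min (max (-x) 0) 1" 1]
    powr_ge_zero[of "min (max x 0) 1" \<beta>] powr_ge_zero[of "min (max (-x) 0) 1" \<beta>]
  unfolding signed_powr_def abs_le_iff by (simp del: powr_ge_zero)

text \<open>The truncations are 1-Lipschitz, so each of the two terms is Hoelder continuous with
  constant 1. Estimating them separately costs the factor 2.\<close>

lemma signed_powr_holder:
  assumes "0 < \<beta>" "\<beta> \<le> 1"
  shows "\<bar>signed_powr \<beta> x - signed_powr \<beta> y\<bar> \<le> 2 * \<bar>x - y\<bar> powr \<beta>"
proof -
  have *: "\<bar>min (max u 0) 1 powr \<beta> - min (max v 0) 1 powr \<beta>\<bar> \<le> \<bar>u - v\<bar> powr \<beta>" for u v :: real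
  proof -
    have "\<bar>min (max u 0) 1 powr \<beta> - min (max v 0) 1 powr \<beta>\<bar>
      \<le> \<bar>min (max u 0) 1 - min (max v 0) 1\<bar> powr \<beta>"
      using assms by (intro powr_abs_diff_le) auto
    also have "\<dots> \<le> \<bar>u - v\<bar> powr \<beta>"
      using assms by (intro powr_mono2) auto
    finally show ?thesis .
  qed
  show ?thesis
    unfolding signed_powr_def using abs_triangle_ineq4[THEN order_trans, OF add_mono[OF *[of x y] *[of "-x" "-y"]]]
    by (simp add: algebra_simps abs_minus_commute[of y x])
qed

lemma continuous_signed_powr:
  assumes "0 < \<beta>" shows "continuous_on UNIV (signed_powr \<beta>)"
  unfolding signed_powr_def using assms
  by (intro continuous_on_diff continuous_on_powr' continuous_intros) auto

lemma signed_powr_measurable [measurable]: "signed_powr \<beta> \<in> borel_measurable borel"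
  unfolding signed_powr_def by measurable

section \<open>Integrals against a power of time singular at 0\<close>

lemma nn_integral_powr_from_0:
  fixes a c :: real
  assumes "- 1 < a" "0 \<le> c"
  shows "(\<integral>\<^sup>+x. ennreal (indicator {0..c} x * x powr a) \<partial>lborel) = ennreal (c powr (a + 1) / (a + 1))"
proof (rule nn_integral_has_integral_lborel)
  have "((\<lambda>x. if x \<in> {0..c} then x powr a else 0) has_integral (c powr (a+1) / (a+1))) UNIV"
    using has_integral_powr_from_0[OF assms] by (simp only: has_integral_restrict_UNIV)
  also have "(\<lambda>x. if x \<in> {0..c} then x powr a else 0) = (\<lambda>x. indicator {0..c} x * x powr a)"
    by (auto simp: indicator_def)
  finally show "((\<lambda>x. indicator {0..c} x * x powr a) has_integral (c powr (a+1) / (a+1))) UNIV" .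
qed auto

lemma has_bochner_integral_powr_from_0:
  fixes a c :: real
  assumes "- 1 < a" "0 \<le> c"
  shows "has_bochner_integral lborel (\<lambda>x. indicator {0..c} x *\<^sub>R x powr a) (c powr (a + 1) / (a + 1))"
  using nn_integral_powr_from_0[OF assms] assms
  by (intro has_bochner_integral_nn_integral) auto

lemma set_integrable_powr_from_0:
  fixes a c :: real
  assumes "- 1 < a"
  shows "set_integrable lborel {0..c} (\<lambda>x. x powr a)"
  using has_bochner_integral_powr_from_0[OF assms, of c]
  unfolding set_integrable_def has_bochner_integral_iff by (cases "0 \<le> c") auto

lemma set_integral_powr_from_0:
  fixes a c :: real
  assumes "- 1 < a" "0 \<le> c"
  shows "(LINT x:{0..c}|lborel. x powr a) = c powr (a + 1) / (a + 1)"
  using has_bochner_integral_powr_from_0[OF assms]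
  unfolding set_lebesgue_integral_def has_bochner_integral_iff by auto

definition powr_primitive :: "real \<Rightarrow> real \<Rightarrow> real" where
  "powr_primitive \<gamma> t = (LINT s:{0..t}|lborel. s powr - \<gamma>)"

text \<open>The \<open>max t 0\<close> covers negative times, where the interval of integration is
  empty. The primitive is thus continuous on the whole line.\<close>

lemma powr_primitive_eq:
  assumes "\<gamma> < 1" shows "powr_primitive \<gamma> t = max t 0 powr (1 - \<gamma>) / (1 - \<gamma>)"
proof (cases "0 \<le> t")
  case True
  then show ?thesis using set_integral_powr_from_0[of "- \<gamma>" t] assms
    by (simp add: powr_primitive_def)
qed (simp add: powr_primitive_def set_lebesgue_integral_def)

lemma continuous_powr_primitive:
  assumes "\<gamma> < 1" shows "continuous_on UNIV (powr_primitive \<gamma>)"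
  unfolding powr_primitive_eq[OF assms, abs_def] using assms
  by (intro continuous_on_divide continuous_on_powr' continuous_intros) auto

definition weighted_integral :: "real \<Rightarrow> (real \<Rightarrow> real) \<Rightarrow> real \<Rightarrow> real" where
  "weighted_integral \<gamma> f t = (LINT s:{0..t}|lborel. s powr - \<gamma> * f s)"

context
  fixes \<gamma> :: real
  assumes \<gamma>: "\<gamma> < 1"
begin

lemma set_integrable_weighted:
  assumes [measurable]: "f \<in> borel_measurable borel" and "\<And>s. \<bar>f s\<bar> \<le> 1"
  shows "set_integrable lborel {0..t} (\<lambda>s. s powr - \<gamma> * f s)"
proof (rule set_integrable_bound[OF set_integrable_powr_from_0[of "- \<gamma>" t]])
  show "- 1 < - \<gamma>" using \<gamma> by simp
  show "set_borel_measurable lborel {0..t} (\<lambda>s. s powr - \<gamma> * f s)"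
    unfolding set_borel_measurable_def by measurable
  have "norm (s powr - \<gamma> * f s) \<le> norm (s powr - \<gamma>)" for s
    using assms(2)[of s] by (simp add: abs_mult mult_left_le)
  then show "AE s in lborel. s \<in> {0..t} \<longrightarrow> norm (s powr - \<gamma> * f s) \<le> norm (s powr - \<gamma>)"
    by simp
qed

lemma weighted_integral_mono:
  assumes [measurable]: "f \<in> borel_measurable borel" "g \<in> borel_measurable borel"
    and "\<And>s. \<bar>f s\<bar> \<le> 1" "\<And>s. \<bar>g s\<bar> \<le> 1" "\<And>s. 0 \<le> s \<Longrightarrow> s \<le> t \<Longrightarrow> f s \<le> g s"
  shows "weighted_integral \<gamma> f t \<le> weighted_integral \<gamma> g t"
  unfolding weighted_integral_def
proof (intro set_integral_mono set_integrable_weighted)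
  show "s powr - \<gamma> * f s \<le> s powr - \<gamma> * g s" if "s \<in> {0..t}" for s
    using that assms(5)[of s] by (intro mult_left_mono) auto
qed (use assms in auto)

text \<open>The integrand is dominated by the weight on the set gained between \<open>s\<close> and
  \<open>t\<close>. The resulting modulus of continuity is the same for all \<open>f\<close> bounded
  by 1.\<close>

lemma weighted_integral_diff:
  assumes [measurable]: "f \<in> borel_measurable borel" and "\<And>s. \<bar>f s\<bar> \<le> 1" "s \<le> t"
  shows "\<bar>weighted_integral \<gamma> f t - weighted_integral \<gamma> f s\<bar>
    \<le> powr_primitive \<gamma> t - powr_primitive \<gamma> s"
proof -
  \<comment> \<open>This is the part of \<open>{0..t}\<close> outside \<open>{0..s}\<close>. For
    negative \<open>s\<close> the latter is empty and nothing is to be removed.\<close>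
  let ?A = "if 0 \<le> s then {s<..t} else {0..t}"
  have un: "{0..t} = {0..s} \<union> ?A" "{0..s} \<inter> ?A = {}"
    using assms(3) by auto
  have sub: "set_integrable lborel ?A (\<lambda>s. s powr - \<gamma> * f s)"
    by (rule set_integrable_subset[OF set_integrable_weighted[of f t]]) (use assms in auto)
  have sub1: "set_integrable lborel ?A (\<lambda>s. s powr - \<gamma>)"
    by (rule set_integrable_subset[OF set_integrable_powr_from_0[of "-\<gamma>" t]]) (use \<gamma> in auto)
  have "weighted_integral \<gamma> f t = weighted_integral \<gamma> f s + (LINT s:?A|lborel. s powr - \<gamma> * f s)"
    using set_integral_Un[OF un(2) set_integrable_weighted[OF assms(1,2)] sub]
    unfolding weighted_integral_def un(1)[symmetric] .
  moreover have "powr_primitive \<gamma> t = powr_primitive \<gamma> s + (LINT s:?A|lborel. s powr - \<gamma>)"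
    using set_integral_Un[OF un(2) set_integrable_powr_from_0 sub1] \<gamma>
    unfolding powr_primitive_def un(1)[symmetric] by simp
  moreover have "\<bar>LINT s:?A|lborel. s powr - \<gamma> * f s\<bar> \<le> (LINT s:?A|lborel. \<bar>s powr - \<gamma> * f s\<bar>)"
    using set_integral_norm_bound[OF sub] by simp
  moreover have "(LINT s:?A|lborel. \<bar>s powr - \<gamma> * f s\<bar>) \<le> (LINT s:?A|lborel. s powr - \<gamma>)"
  proof (intro set_integral_mono set_integrable_abs[OF sub] sub1)
    show "\<bar>s powr - \<gamma> * f s\<bar> \<le> s powr - \<gamma>" for s
      using assms(2)[of s] by (simp add: abs_mult mult_left_le)
  qed
  ultimately show ?thesis by simp
qed

lemma continuous_weighted_integral:
  assumes [measurable]: "f \<in> borel_measurable borel" and "\<And>s. \<bar>f s\<bar> \<le> 1"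
  shows "continuous_on UNIV (weighted_integral \<gamma> f)"
proof -
  have bd: "\<bar>weighted_integral \<gamma> f t - weighted_integral \<gamma> f s\<bar>
    \<le> \<bar>powr_primitive \<gamma> t - powr_primitive \<gamma> s\<bar>" for s t
    using weighted_integral_diff[OF assms, of s t] weighted_integral_diff[OF assms, of t s]
    by (cases "s \<le> t") auto
  have "(weighted_integral \<gamma> f \<longlongrightarrow> weighted_integral \<gamma> f s) (at s)" for s
  proof -
    have "(powr_primitive \<gamma> \<longlongrightarrow> powr_primitive \<gamma> s) (at s)"
      using continuous_powr_primitive[OF \<gamma>] by (simp add: continuous_on_def)
    then have *: "((\<lambda>t. \<bar>powr_primitive \<gamma> t - powr_primitive \<gamma> s\<bar>) \<longlongrightarrow> 0) (at s)"
      by (simp add: LIM_zero tendsto_rabs_zero)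
    have "((\<lambda>t. weighted_integral \<gamma> f t - weighted_integral \<gamma> f s) \<longlongrightarrow> 0) (at s)"
      by (rule Lim_null_comparison[OF _ *]) (use bd in auto)
    then show ?thesis by (rule LIM_zero_cancel)
  qed
  then show ?thesis by (simp add: continuous_on_def)
qed

lemma weighted_integral_le_primitive:
  assumes [measurable]: "f \<in> borel_measurable borel" and "\<And>s. \<bar>f s\<bar> \<le> 1"
  shows "weighted_integral \<gamma> f t \<le> powr_primitive \<gamma> t"
proof -
  have "f s \<le> 1" for s using assms(2)[of s] by linarith
  then have "weighted_integral \<gamma> f t \<le> weighted_integral \<gamma> (\<lambda>_. 1) t"
    using assms by (intro weighted_integral_mono) auto
  then show ?thesis by (simp add: weighted_integral_def powr_primitive_def)
qed

end

text \<open>Only the drift part of the solution is iterated; \<open>l\<close> is a fixed path of the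
  scalar noise. The starting function is the primitive of the weight, an upper bound for every
  possible drift integral, so that the iterates decrease.\<close>

primrec drift_iter :: "real \<Rightarrow> real \<Rightarrow> (real \<Rightarrow> real) \<Rightarrow> nat \<Rightarrow> real \<Rightarrow> real" where
  "drift_iter \<gamma> \<beta> l 0 = powr_primitive \<gamma>"
| "drift_iter \<gamma> \<beta> l (Suc n) =
     weighted_integral \<gamma> (\<lambda>s. signed_powr \<beta> (drift_iter \<gamma> \<beta> l n s + l s))"

definition max_drift :: "real \<Rightarrow> real \<Rightarrow> (real \<Rightarrow> real) \<Rightarrow> real \<Rightarrow> real" where
  "max_drift \<gamma> \<beta> l t = lim (\<lambda>n. drift_iter \<gamma> \<beta> l n t)"

context
  fixes \<gamma> \<beta> :: real and l :: "real \<Rightarrow> real"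
  assumes \<gamma>: "\<gamma> < 1" and \<beta>: "0 < \<beta>" and l [measurable]: "l \<in> borel_measurable borel"
begin

lemma drift_iter_continuous: "continuous_on UNIV (drift_iter \<gamma> \<beta> l n)"
proof (induction n)
  case 0
  show ?case using continuous_powr_primitive[OF \<gamma>] by simp
next
  case (Suc n)
  then have [measurable]: "drift_iter \<gamma> \<beta> l n \<in> borel_measurable borel"
    by (rule borel_measurable_continuous_onI)
  show ?case
    using \<beta> by (auto intro!: continuous_weighted_integral[OF \<gamma>] abs_signed_powr_le_1)
qed

lemma drift_iter_measurable [measurable]: "drift_iter \<gamma> \<beta> l n \<in> borel_measurable borel"
  using drift_iter_continuous by (rule borel_measurable_continuous_onI)

text \<open>The first step goes down because the integrand is at most the weight. Monotonicity of
  \<open>signed_powr\<close> propagates the inequality to all later steps.\<close>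

lemma drift_iter_Suc_le: "drift_iter \<gamma> \<beta> l (Suc n) t \<le> drift_iter \<gamma> \<beta> l n t"
proof (induction n arbitrary: t)
  case 0
  show ?case
    using weighted_integral_le_primitive[OF \<gamma>] abs_signed_powr_le_1[OF \<beta>]
      drift_iter_measurable[of 0] by simp
next
  case (Suc n)
  have "weighted_integral \<gamma> (\<lambda>s. signed_powr \<beta> (drift_iter \<gamma> \<beta> l (Suc n) s + l s)) t
    \<le> weighted_integral \<gamma> (\<lambda>s. signed_powr \<beta> (drift_iter \<gamma> \<beta> l n s + l s)) t"
    by (intro weighted_integral_mono[OF \<gamma>] abs_signed_powr_le_1[OF \<beta>] signed_powr_mono[OF \<beta>]
      add_right_mono Suc measurable_compose[OF _ signed_powr_measurable]
      borel_measurable_add drift_iter_measurable l)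
  then show ?case by simp
qed

text \<open>The integrand is also at least minus the weight. This floor makes the decreasing
  iteration converge.\<close>

lemma drift_iter_ge: "- powr_primitive \<gamma> t \<le> drift_iter \<gamma> \<beta> l n t"
proof (cases n)
  case 0
  then show ?thesis using powr_primitive_eq[OF \<gamma>, of t] \<gamma> by simp
next
  case (Suc m)
  have "weighted_integral \<gamma> (\<lambda>_. -1) t \<le> drift_iter \<gamma> \<beta> l (Suc m) t"
    unfolding drift_iter.simps
  proof (intro weighted_integral_mono[OF \<gamma>] abs_signed_powr_le_1[OF \<beta>])
    show "- 1 \<le> signed_powr \<beta> (drift_iter \<gamma> \<beta> l m s + l s)" for s
      using abs_signed_powr_le_1[OF \<beta>, of "drift_iter \<gamma> \<beta> l m s + l s"] by linarith
  qed (auto intro!: measurable_compose[OF _ signed_powr_measurable])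
  moreover have "weighted_integral \<gamma> (\<lambda>_. -1) t = - powr_primitive \<gamma> t"
    by (simp add: weighted_integral_def powr_primitive_def set_lebesgue_integral_def)
  ultimately show ?thesis using Suc by metis
qed

lemma drift_iter_tendsto: "(\<lambda>n. drift_iter \<gamma> \<beta> l n t) \<longlonglongrightarrow> max_drift \<gamma> \<beta> l t"
proof -
  have "decseq (\<lambda>n. drift_iter \<gamma> \<beta> l n t)"
    by (intro decseq_SucI drift_iter_Suc_le)
  moreover have "\<forall>n. - powr_primitive \<gamma> t \<le> drift_iter \<gamma> \<beta> l n t"
    using drift_iter_ge by blast
  ultimately obtain y where "(\<lambda>n. drift_iter \<gamma> \<beta> l n t) \<longlonglongrightarrow> y"
    using decseq_convergent by blast
  then show ?thesis by (metis max_drift_def limI)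
qed

lemma max_drift_measurable [measurable]: "max_drift \<gamma> \<beta> l \<in> borel_measurable borel"
  using drift_iter_tendsto by (rule borel_measurable_LIMSEQ_real) measurable

text \<open>The limit passes through the continuous \<open>signed_powr\<close> and, by dominated
  convergence with majorant \<open>s powr - \<gamma>\<close>, through the integral. The shifted
  sequence has the same limit.\<close>

lemma max_drift_fixed_point:
  "max_drift \<gamma> \<beta> l t = weighted_integral \<gamma> (\<lambda>s. signed_powr \<beta> (max_drift \<gamma> \<beta> l s + l s)) t"
proof (rule LIMSEQ_unique)
  show "(\<lambda>n. drift_iter \<gamma> \<beta> l (Suc n) t) \<longlonglongrightarrow> max_drift \<gamma> \<beta> l t"
    by (rule LIMSEQ_Suc[OF drift_iter_tendsto])
  have cont: "isCont (signed_powr \<beta>) x" for x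
    using continuous_signed_powr[OF \<beta>] by (simp add: continuous_on_eq_continuous_at)
  show "(\<lambda>n. drift_iter \<gamma> \<beta> l (Suc n) t) \<longlonglongrightarrow>
    weighted_integral \<gamma> (\<lambda>s. signed_powr \<beta> (max_drift \<gamma> \<beta> l s + l s)) t"
    unfolding drift_iter.simps weighted_integral_def set_lebesgue_integral_def
  proof (rule integral_dominated_convergence)
    show "integrable lborel (\<lambda>s. indicator {0..t} s *\<^sub>R s powr - \<gamma>)"
      using set_integrable_powr_from_0[of "-\<gamma>" t] \<gamma> by (simp add: set_integrable_def)
    show "AE s in lborel. (\<lambda>n. indicator {0..t} s *\<^sub>R (s powr - \<gamma> *
        signed_powr \<beta> (drift_iter \<gamma> \<beta> l n s + l s)))
      \<longlonglongrightarrow> indicator {0..t} s *\<^sub>R (s powr - \<gamma> * signed_powr \<beta> (max_drift \<gamma> \<beta> l s + l s))"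
      by (intro AE_I2 tendsto_intros isCont_tendsto_compose[OF cont] drift_iter_tendsto)
    show "AE s in lborel. norm (indicator {0..t} s *\<^sub>R (s powr - \<gamma> *
        signed_powr \<beta> (drift_iter \<gamma> \<beta> l n s + l s))) \<le> indicator {0..t} s *\<^sub>R s powr - \<gamma>" for n
      using abs_signed_powr_le_1[OF \<beta>]
      by (intro AE_I2) (auto simp: abs_mult indicator_def intro!: mult_left_le)
  qed measurable
qed

lemma max_drift_continuous: "continuous_on UNIV (max_drift \<gamma> \<beta> l)"
proof -
  have "max_drift \<gamma> \<beta> l = weighted_integral \<gamma> (\<lambda>s. signed_powr \<beta> (max_drift \<gamma> \<beta> l s + l s))"
    by (rule ext) (rule max_drift_fixed_point)
  moreover have "continuous_on UNIV (weighted_integral \<gamma> (\<lambda>s. signed_powr \<beta> (max_drift \<gamma> \<beta> l s + l s)))"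
    by (intro continuous_weighted_integral[OF \<gamma>] abs_signed_powr_le_1[OF \<beta>]) measurable
  ultimately show ?thesis by metis
qed

text \<open>The exponent \<open>\<kappa> = (1 - \<gamma>) / (1 - \<beta>)\<close> is the one for which \<open>t\<^sup>\<kappa>\<close> reproduces itself, up to a
  constant, under \<open>y \<mapsto> \<integral> s\<^sup>-\<^sup>\<gamma> y\<^sup>\<beta> ds\<close>.\<close>

lemma max_drift_lower:
  assumes "\<beta> < 1" and \<kappa>: "\<kappa> = (1 - \<gamma>) / (1 - \<beta>)" and "0 < c" and c: "c \<le> (c / 2) powr \<beta> / \<kappa>"
    and t0: "c * t0 powr \<kappa> \<le> 1" "c * t0 powr (\<kappa> - (1 - \<gamma>)) * (1 - \<gamma>) \<le> 1"
    and small: "\<And>s. 0 < s \<Longrightarrow> s \<le> t0 \<Longrightarrow> - (c / 2) * s powr \<kappa> \<le> l s"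
    and t: "0 < t" "t \<le> t0"
  shows "c * t powr \<kappa> \<le> max_drift \<gamma> \<beta> l t"
proof (rule LIMSEQ_le_const[OF drift_iter_tendsto])
  have \<kappa>pos: "0 < \<kappa>" using \<kappa> \<gamma> assms(1) by simp
  \<comment> \<open>This is the balance of exponents: \<open>s powr - \<gamma>\<close> times the
    \<beta>-th power of \<open>s powr \<kappa>\<close> is \<open>s powr (\<kappa> - 1)\<close>,
    whose primitive is a multiple of \<open>t powr \<kappa>\<close>.\<close>
  have \<kappa>eq: "\<kappa> * \<beta> - \<gamma> = \<kappa> - 1" using \<kappa> assms(1) by (simp add: field_simps)
  have "0 \<le> \<kappa> * \<beta>" using \<kappa>pos \<beta> by simp
  then have \<kappa>ge: "1 - \<gamma> \<le> \<kappa>" using \<kappa>eq by linarith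
  have "c * t powr \<kappa> \<le> drift_iter \<gamma> \<beta> l n t" for n
    using t
  proof (induction n arbitrary: t)
    case 0
    \<comment> \<open>The start of the iteration grows like \<open>t powr (1 - \<gamma>)\<close>,
      and \<kappa> is at least this exponent. The second condition on \<open>t0\<close> makes the
      lower barrier stay below it.\<close>
    have "c * t powr \<kappa> * (1 - \<gamma>) = t powr (1 - \<gamma>) * (c * t powr (\<kappa> - (1 - \<gamma>)) * (1 - \<gamma>))"
      using 0 by (simp add: powr_diff)
    also have "\<dots> \<le> t powr (1 - \<gamma>) * (c * t0 powr (\<kappa> - (1 - \<gamma>)) * (1 - \<gamma>))"
      using 0 \<kappa>ge \<gamma> \<open>0 < c\<close> by (intro mult_left_mono mult_right_mono powr_mono2) auto
    also have "\<dots> \<le> t powr (1 - \<gamma>)"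
      using t0(2) by (simp add: mult_left_le)
    finally show ?case
      using 0 \<gamma> by (simp add: powr_primitive_eq[OF \<gamma>] pos_le_divide_eq)
  next
    case (Suc n)
    \<comment> \<open>Up to \<open>t0\<close> the truncation at 1 in \<open>signed_powr\<close> is
      inactive on the barrier.\<close>
    have cs: "c / 2 * s powr \<kappa> \<le> 1" if "0 < s" "s \<le> t0" for s
    proof -
      have "s powr \<kappa> \<le> t0 powr \<kappa>" using that \<kappa>pos by (intro powr_mono2) auto
      then have "c * s powr \<kappa> \<le> c * t0 powr \<kappa>" using \<open>0 < c\<close> by simp
      then have "c * s powr \<kappa> \<le> 1" using t0(1) by simp
      moreover have "c / 2 * s powr \<kappa> \<le> c * s powr \<kappa>" using \<open>0 < c\<close> by simp
      ultimately show ?thesis by linarith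
    qed
    \<comment> \<open>The condition on \<open>c\<close> says that the barrier with half its
      constant, passed once through the integral, still dominates the full barrier.\<close>
    have "c * t powr \<kappa> \<le> (c / 2) powr \<beta> / \<kappa> * t powr \<kappa>"
      using c by (intro mult_right_mono) auto
    also have "\<dots> = (c / 2) powr \<beta> * (LINT s:{0..t}|lborel. s powr (\<kappa> - 1))"
      using set_integral_powr_from_0[of "\<kappa> - 1" t] \<kappa>pos Suc.prems by simp
    also have "\<dots> = (LINT s:{0..t}|lborel. (c / 2) powr \<beta> * s powr (\<kappa> - 1))"
      by simp
    also have "\<dots> \<le> drift_iter \<gamma> \<beta> l (Suc n) t"
      unfolding drift_iter.simps weighted_integral_def
    proof (intro set_integral_mono set_integrable_mult_right set_integrable_powr_from_0
        set_integrable_weighted \<gamma> abs_signed_powr_le_1[OF \<beta>])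
      fix s assume s: "s \<in> {0..t}"
      show "(c / 2) powr \<beta> * s powr (\<kappa> - 1)
        \<le> s powr - \<gamma> * signed_powr \<beta> (drift_iter \<gamma> \<beta> l n s + l s)"
      \<comment> \<open>At \<open>s = 0\<close> both sides vanish, because
        \<open>0 powr a = 0\<close> for every exponent.\<close>
      proof (cases "s = 0")
        case False
        with s Suc.prems have s': "0 < s" "s \<le> t0" by auto
        have "(c / 2) powr \<beta> * s powr (\<kappa> - 1) = (c / 2) powr \<beta> * (s powr (- \<gamma>) * s powr (\<kappa> * \<beta>))"
          using \<kappa>eq s' by (simp flip: powr_add)
        also have "\<dots> = s powr (- \<gamma>) * (c / 2 * s powr \<kappa>) powr \<beta>"
          using \<open>0 < c\<close> by (simp add: powr_mult powr_powr powr_divide)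
        also have "\<dots> = s powr (- \<gamma>) * signed_powr \<beta> (c / 2 * s powr \<kappa>)"
          using s' \<open>0 < c\<close> cs[OF s'] by (subst signed_powr_pos) auto
        also have "\<dots> \<le> s powr - \<gamma> * signed_powr \<beta> (drift_iter \<gamma> \<beta> l n s + l s)"
          \<comment> \<open>The iterate supplies \<open>c * s powr \<kappa>\<close>, and the noise
            takes away at most half of it.\<close>
          using Suc.IH[OF s'] small[OF s'] by (intro mult_left_mono signed_powr_mono \<beta>) auto
        finally show ?thesis .
      qed simp
    qed (use \<kappa>pos in simp, measurable)
    finally show ?case .
  qed
  then show "\<exists>N. \<forall>n\<ge>N. c * t powr \<kappa> \<le> drift_iter \<gamma> \<beta> l n t" by blast
qed

end

section \<open>Adaptedness of the iteration\<close>

lemma grid_tendsto_right: "filterlim (\<lambda>n. (real_of_int \<lfloor>s * real (Suc n)\<rfloor> + 1) / real (Suc n)) (at_right s) sequentially"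
  (is "filterlim ?q _ _")
proof -
  \<comment> \<open>The \<open>+ 1\<close> after the floor yields the next grid point strictly to
    the right of \<open>s\<close>, as a limit along \<open>at_right s\<close> requires.\<close>
  have lower: "s < ?q n" for n
    by (simp add: pos_less_divide_eq del: of_nat_Suc)
  have upper: "?q n \<le> s + 1 / real (Suc n)" for n
    using of_int_floor_le[of "s * real (Suc n)"]
    by (simp add: field_simps del: of_nat_Suc of_int_floor_le)
  have "?q \<longlonglongrightarrow> s"
  proof (rule tendsto_sandwich[OF _ _ tendsto_const])
    show "(\<lambda>n. s + 1 / real (Suc n)) \<longlonglongrightarrow> s"
      using tendsto_add[OF tendsto_const LIMSEQ_inverse_real_of_nat, of s] by (simp add: inverse_eq_divide)
  qed (use upper lower in \<open>auto intro!: always_eventually less_imp_le\<close>)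
  moreover have "?q n \<in> {s<..} \<and> ?q n \<noteq> s" for n
    using lower[of n] by (metis greaterThan_iff less_irrefl)
  ultimately show ?thesis
    unfolding filterlim_at by (intro conjI always_eventually allI) blast+
qed

text \<open>Reading the function at the next grid point gives step functions with countably many
  pieces; by right-continuity they converge to the function itself.\<close>

lemma borel_measurable_right_continuous:
  fixes f :: "real \<Rightarrow> real"
  assumes "\<And>s. (f \<longlongrightarrow> f s) (at_right s)"
  shows "f \<in> borel_measurable borel"
proof (rule borel_measurable_LIMSEQ_real)
  show "(\<lambda>n. f ((real_of_int \<lfloor>s * real (Suc n)\<rfloor> + 1) / real (Suc n))) \<longlonglongrightarrow> f s" for s
    by (rule filterlim_compose[OF assms grid_tendsto_right])
  show "(\<lambda>s. f ((real_of_int \<lfloor>s * real (Suc n)\<rfloor> + 1) / real (Suc n))) \<in> borel_measurable borel" for n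
    by (rule measurable_compose_countable[where f = "\<lambda>i s. f ((real_of_int i + 1) / real (Suc n))"])
      measurable
qed

text \<open>This is progressive measurability. The clamp \<open>min s t\<close> keeps the
  approximating grid times from reading \<open>Z\<close> after \<open>t\<close>, so measurability up
  to \<open>t\<close> suffices. Before \<open>t\<close> the grid points eventually lie below
  \<open>t\<close>; from \<open>t\<close> on, everything is frozen at \<open>t\<close>.\<close>

lemma jointly_measurable_right_continuous:
  fixes Z :: "real \<Rightarrow> 'w \<Rightarrow> real"
  assumes rc: "\<And>s \<omega>. \<omega> \<in> space N \<Longrightarrow> ((\<lambda>s. Z s \<omega>) \<longlongrightarrow> Z s \<omega>) (at_right s)"
    and meas: "\<And>s. s \<le> t \<Longrightarrow> Z s \<in> borel_measurable N"
  shows "(\<lambda>(\<omega>, s). Z (min s t) \<omega>) \<in> borel_measurable (N \<Otimes>\<^sub>M lborel)"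
proof (rule borel_measurable_LIMSEQ_real)
  let ?q = "\<lambda>n s. (real_of_int \<lfloor>s * real (Suc n)\<rfloor> + 1) / real (Suc n)"
  fix x :: "'w \<times> real" assume x: "x \<in> space (N \<Otimes>\<^sub>M lborel)"
  obtain \<omega> s where [simp]: "x = (\<omega>, s)" by (cases x)
  have \<omega>: "\<omega> \<in> space N" using x by (simp add: space_pair_measure)
  show "(\<lambda>n. case x of (\<omega>, s) \<Rightarrow> Z (min (?q n s) t) \<omega>) \<longlonglongrightarrow> (case x of (\<omega>, s) \<Rightarrow> Z (min s t) \<omega>)"
  proof (cases "s < t")
    case True
    have lim: "(\<lambda>n. Z (?q n s) \<omega>) \<longlonglongrightarrow> Z s \<omega>"
      by (rule filterlim_compose[OF rc[OF \<omega>] grid_tendsto_right])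
    have "(\<lambda>n. ?q n s) \<longlonglongrightarrow> s"
      using grid_tendsto_right[of s] by (simp add: filterlim_at)
    then have "\<forall>\<^sub>F n in sequentially. ?q n s < t"
      using True by (rule order_tendstoD)
    then have "\<forall>\<^sub>F n in sequentially. Z (?q n s) \<omega> = Z (min (?q n s) t) \<omega>"
      by eventually_elim (simp add: min_def)
    from Lim_transform_eventually[OF lim this] show ?thesis using True by simp
  next
    case False
    have "t < ?q n s" for n
    proof -
      have "s < ?q n s" by (simp add: pos_less_divide_eq del: of_nat_Suc)
      then show ?thesis using False by linarith
    qed
    then have "min (?q n s) t = t" for n by (simp add: min_absorb2 less_imp_le)
    then show ?thesis using False by (simp add: min_absorb2)
  qed
next
  fix n
  show "(\<lambda>(\<omega>, s). Z (min ((real_of_int \<lfloor>s * real (Suc n)\<rfloor> + 1) / real (Suc n)) t) \<omega>)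
    \<in> borel_measurable (N \<Otimes>\<^sub>M lborel)"
    unfolding case_prod_beta
  proof (rule measurable_compose_countable[where
        f = "\<lambda>i x. Z (min ((real_of_int i + 1) / real (Suc n)) t) (fst x)"])
    show "(\<lambda>x. Z (min ((real_of_int i + 1) / real (Suc n)) t) (fst x)) \<in> borel_measurable (N \<Otimes>\<^sub>M lborel)" for i
      by (rule measurable_compose[OF measurable_fst meas]) simp
  qed measurable
qed

context
  fixes \<gamma> \<beta> t :: real and Z :: "real \<Rightarrow> 'w \<Rightarrow> real" and N :: "'w measure"
  assumes \<gamma>: "\<gamma> < 1" and \<beta>: "0 < \<beta>"
    and rc: "\<And>s \<omega>. \<omega> \<in> space N \<Longrightarrow> ((\<lambda>s. Z s \<omega>) \<longlongrightarrow> Z s \<omega>) (at_right s)"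
    and meas: "\<And>s. s \<le> t \<Longrightarrow> Z s \<in> borel_measurable N"
begin

text \<open>An iterate is continuous in time, hence jointly measurable together with the noise once
  both are clamped at \<open>t\<close>. Integrating out the time preserves measurability in the
  sample point.\<close>

lemma drift_iter_adapted:
  "r \<le> t \<Longrightarrow> (\<lambda>\<omega>. drift_iter \<gamma> \<beta> (\<lambda>s. Z s \<omega>) n r) \<in> borel_measurable N"
proof (induction n arbitrary: r)
  case 0
  show ?case by simp
next
  case (Suc n)
  let ?D = "\<lambda>s \<omega>. drift_iter \<gamma> \<beta> (\<lambda>s. Z s \<omega>) n s"
  have "((\<lambda>s. ?D s \<omega>) \<longlongrightarrow> ?D s \<omega>) (at_right s)" if "\<omega> \<in> space N" for \<omega> s
    using drift_iter_continuous[OF \<gamma> \<beta> borel_measurable_right_continuous[OF rc[OF that]], of n]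
    unfolding continuous_on_def by (blast intro: tendsto_within_subset)
  then have D [measurable]: "(\<lambda>(\<omega>, s). ?D (min s t) \<omega>) \<in> borel_measurable (N \<Otimes>\<^sub>M lborel)"
    using Suc.IH by (rule jointly_measurable_right_continuous)
  have Z [measurable]: "(\<lambda>(\<omega>, s). Z (min s t) \<omega>) \<in> borel_measurable (N \<Otimes>\<^sub>M lborel)"
    using rc meas by (rule jointly_measurable_right_continuous)
  have "(\<lambda>\<omega>. LINT s|lborel. indicator {0..r} s *\<^sub>R
      (s powr - \<gamma> * signed_powr \<beta> (?D (min s t) \<omega> + Z (min s t) \<omega>))) \<in> borel_measurable N"
    by (rule lborel.borel_measurable_lebesgue_integral) measurable
  \<comment> \<open>The integral runs over \<open>{0..r}\<close> with \<open>r \<le> t\<close>,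
    where the clamp changes nothing.\<close>
  also have "(\<lambda>\<omega>. LINT s|lborel. indicator {0..r} s *\<^sub>R
      (s powr - \<gamma> * signed_powr \<beta> (?D (min s t) \<omega> + Z (min s t) \<omega>))) =
      (\<lambda>\<omega>. drift_iter \<gamma> \<beta> (\<lambda>s. Z s \<omega>) (Suc n) r)"
    unfolding drift_iter.simps weighted_integral_def set_lebesgue_integral_def using Suc.prems
    by (intro ext Bochner_Integration.integral_cong) (auto simp: indicator_def min_def)
  finally show ?case .
qed

lemma max_drift_adapted: "(\<lambda>\<omega>. max_drift \<gamma> \<beta> (\<lambda>s. Z s \<omega>) t) \<in> borel_measurable N"
proof (rule borel_measurable_LIMSEQ_real)
  show "(\<lambda>n. drift_iter \<gamma> \<beta> (\<lambda>s. Z s \<omega>) n t) \<longlonglongrightarrow> max_drift \<gamma> \<beta> (\<lambda>s. Z s \<omega>) t"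
    if "\<omega> \<in> space N" for \<omega>
    by (rule drift_iter_tendsto[OF \<gamma> \<beta> borel_measurable_right_continuous[OF rc[OF that]]])
qed (simp add: drift_iter_adapted)

end

section \<open>Tail estimates and maximal inequality\<close>

text \<open>The integral equals \<open>h - sin (h * z) / z\<close>, and the subtracted quotient is
  at most \<open>1 / \<bar>z\<bar>\<close>, hence at most \<open>h / 2\<close>.\<close>

lemma nn_integral_one_minus_cos_ge:
  fixes z h :: real
  assumes "0 < h" "2 \<le> h * \<bar>z\<bar>"
  shows "ennreal (h / 2) \<le> (\<integral>\<^sup>+u. ennreal (1 - cos (u * z)) * indicator {0..h} u \<partial>lborel)"
proof -
  have z: "z \<noteq> 0" using assms by auto
  have eq: "(\<integral>\<^sup>+u. ennreal (1 - cos (u * z)) * indicator {0..h} u \<partial>lborel)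
    = ennreal ((h - sin (h * z) / z) - (0 - sin (0 * z) / z))"
    using assms z
    by (intro nn_integral_FTC_Icc) (auto intro!: derivative_eq_intros)
  have "\<bar>sin (h * z) / z\<bar> \<le> h / 2"
  proof -
    have "\<bar>sin (h * z) / z\<bar> \<le> 1 / \<bar>z\<bar>"
      by (simp add: divide_right_mono)
    also have "\<dots> \<le> h / 2" using assms z by (simp add: divide_le_eq)
    finally show ?thesis .
  qed
  then have "sin (h * z) / z \<le> h / 2" by (rule abs_le_D1)
  then show ?thesis unfolding eq by (intro ennreal_leI) simp
qed

text \<open>Averaging \<open>1 - cos (u * X)\<close> over small frequencies \<open>u\<close> detects
  large values of \<open>X\<close>. Exchanging the two integrals turns the decay of the expectation
  as \<open>u\<close> tends to 0 into a tail bound.\<close>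

lemma (in prob_space) tail_bound_from_cos:
  fixes X :: "'a \<Rightarrow> real"
  assumes [measurable]: "X \<in> borel_measurable M" and "0 \<le> K" "0 < a" "0 < x"
    and cos: "\<And>u. 0 < u \<Longrightarrow> expectation (\<lambda>\<omega>. 1 - cos (u * X \<omega>)) \<le> K * u powr a"
  shows "prob {\<omega>\<in>space M. x < \<bar>X \<omega>\<bar>} \<le> 2 * K * (2 / x) powr a"
proof -
  \<comment> \<open>With this frequency window, \<open>x < \<bar>X\<bar>\<close> implies
    \<open>2 \<le> h * \<bar>X\<bar>\<close>, so the inner integral is at least \<open>h / 2\<close>
    on the tail event.\<close>
  define h where "h = 2 / x"
  have h: "0 < h" using assms by (simp add: h_def)
  interpret L: pair_sigma_finite M lborel ..
  have "ennreal (h / 2) * emeasure M {\<omega>\<in>space M. x < \<bar>X \<omega>\<bar>}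
    = (\<integral>\<^sup>+\<omega>. ennreal (h / 2) * indicator {\<omega>\<in>space M. x < \<bar>X \<omega>\<bar>} \<omega> \<partial>M)"
    by (simp add: nn_integral_cmult_indicator)
  also have "\<dots> \<le> (\<integral>\<^sup>+\<omega>. (\<integral>\<^sup>+u. ennreal (1 - cos (u * X \<omega>)) * indicator {0..h} u \<partial>lborel) \<partial>M)"
  proof (rule nn_integral_mono)
    fix \<omega> assume "\<omega> \<in> space M"
    show "ennreal (h / 2) * indicator {\<omega>\<in>space M. x < \<bar>X \<omega>\<bar>} \<omega>
      \<le> (\<integral>\<^sup>+u. ennreal (1 - cos (u * X \<omega>)) * indicator {0..h} u \<partial>lborel)"
    proof (cases "x < \<bar>X \<omega>\<bar>")
      case True
      then have "2 \<le> h * \<bar>X \<omega>\<bar>" using \<open>0 < x\<close> by (simp add: h_def field_simps)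
      then show ?thesis
        using nn_integral_one_minus_cos_ge[OF h] True \<open>\<omega> \<in> space M\<close> by simp
    qed simp
  qed
  also have "\<dots> = (\<integral>\<^sup>+u. (\<integral>\<^sup>+\<omega>. ennreal (1 - cos (u * X \<omega>)) * indicator {0..h} u \<partial>M) \<partial>lborel)"
    by (rule L.Fubini'[symmetric]) measurable
  also have "\<dots> \<le> (\<integral>\<^sup>+u. ennreal K * ennreal (indicator {0..h} u * u powr a) \<partial>lborel)"
  proof (rule nn_integral_mono)
    fix u :: real
    have int: "integrable M (\<lambda>\<omega>. 1 - cos (u * X \<omega>))"
    proof (rule integrable_const_bound[of _ 2])
      have "norm (1 - cos y) \<le> 2" for y :: real
        using cos_ge_minus_one[of y] cos_le_one[of y] by simp
      then show "AE \<omega> in M. norm (1 - cos (u * X \<omega>)) \<le> 2" by simp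
    qed measurable
    have "(\<integral>\<^sup>+\<omega>. ennreal (1 - cos (u * X \<omega>)) \<partial>M) \<le> ennreal (K * u powr a)" if "0 \<le> u"
    proof (cases "u = 0")
      case False
      then have "(\<integral>\<^sup>+\<omega>. ennreal (1 - cos (u * X \<omega>)) \<partial>M) = ennreal (expectation (\<lambda>\<omega>. 1 - cos (u * X \<omega>)))"
        by (intro nn_integral_eq_integral int) auto
      also have "\<dots> \<le> ennreal (K * u powr a)"
        using that False by (intro ennreal_leI cos) auto
      finally show ?thesis .
    qed simp
    then show "(\<integral>\<^sup>+\<omega>. ennreal (1 - cos (u * X \<omega>)) * indicator {0..h} u \<partial>M)
      \<le> ennreal K * ennreal (indicator {0..h} u * u powr a)"
      using \<open>0 \<le> K\<close> by (auto simp: indicator_def ennreal_mult)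
  qed
  also have "\<dots> = ennreal K * ennreal (h powr (a + 1) / (a + 1))"
    using h assms by (subst nn_integral_cmult) (auto simp: nn_integral_powr_from_0)
  also have "\<dots> = ennreal (K * (h powr (a + 1) / (a + 1)))"
    using \<open>0 \<le> K\<close> \<open>0 < a\<close> by (intro ennreal_mult[symmetric]) auto
  also have "\<dots> \<le> ennreal (K * h powr (a + 1))"
  proof (intro ennreal_leI mult_left_mono)
    show "h powr (a + 1) / (a + 1) \<le> h powr (a + 1)"
      using \<open>0 < a\<close> divide_left_mono[of 1 "a + 1" "h powr (a + 1)"] by simp
  qed (fact \<open>0 \<le> K\<close>)
  finally have "ennreal (h / 2 * prob {\<omega>\<in>space M. x < \<bar>X \<omega>\<bar>}) \<le> ennreal (K * h powr (a + 1))"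
    using h by (simp add: emeasure_eq_measure ennreal_mult[symmetric])
  then have "h / 2 * prob {\<omega>\<in>space M. x < \<bar>X \<omega>\<bar>} \<le> K * h powr (a + 1)"
    using assms by (subst (asm) ennreal_le_iff) auto
  then have "h * prob {\<omega>\<in>space M. x < \<bar>X \<omega>\<bar>} \<le> h * (2 * K * h powr a)"
    using h by (simp add: powr_add mult_ac)
  then show ?thesis using h unfolding h_def by (simp only: mult_le_cancel_left_pos)
qed

text \<open>Ottaviani's inequality. At the first index where the level \<open>2 * x\<close> is
  exceeded, the remaining increment is independent of the past and at most \<open>x\<close> with
  probability at least \<open>1 - q\<close>; then the final value still exceeds
  \<open>x\<close>.\<close>

lemma (in prob_space) ottaviani_discrete:
  fixes S :: "nat \<Rightarrow> 'a \<Rightarrow> real" and G :: "nat \<Rightarrow> 'a measure"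
  assumes sub: "\<And>k. k \<le> n \<Longrightarrow> subalgebra M (G k)"
    and mono: "\<And>j k. j \<le> k \<Longrightarrow> k \<le> n \<Longrightarrow> sets (G j) \<subseteq> sets (G k)"
    and meas: "\<And>k. k \<le> n \<Longrightarrow> S k \<in> borel_measurable (G k)"
    and indep: "\<And>k A. k \<le> n \<Longrightarrow> A \<in> sets (G k) \<Longrightarrow>
      prob (A \<inter> {\<omega>\<in>space M. \<bar>S n \<omega> - S k \<omega>\<bar> \<le> x}) = prob A * prob {\<omega>\<in>space M. \<bar>S n \<omega> - S k \<omega>\<bar> \<le> x}"
    and q: "\<And>k. k \<le> n \<Longrightarrow> 1 - q \<le> prob {\<omega>\<in>space M. \<bar>S n \<omega> - S k \<omega>\<bar> \<le> x}"
  shows "prob {\<omega>\<in>space M. \<exists>k\<le>n. 2 * x < \<bar>S k \<omega>\<bar>} * (1 - q) \<le> prob {\<omega>\<in>space M. x < \<bar>S n \<omega>\<bar>}"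
proof -
  have spG: "space (G k) = space M" if "k \<le> n" for k
    using sub[OF that] by (simp add: subalgebra_def)
  have S: "S k \<in> borel_measurable M" if "k \<le> n" for k
    using measurable_from_subalg[OF sub[OF that] meas[OF that]] .
  have [measurable]: "S n \<in> borel_measurable M" by (rule S) simp
  \<comment> \<open>The first exceedance occurs at index \<open>k\<close>. These events are
    disjoint, and \<open>A k\<close> depends only on the past up to \<open>k\<close>.\<close>
  define A where "A k = {\<omega>\<in>space M. 2 * x < \<bar>S k \<omega>\<bar> \<and> (\<forall>j\<in>{..<k}. \<bar>S j \<omega>\<bar> \<le> 2 * x)}" for k
  have A_G: "A k \<in> sets (G k)" if "k \<le> n" for k
  proof -
    have S_G: "S j \<in> borel_measurable (G k)" if "j \<le> k" for j
    proof -
      have "j \<le> n" using that \<open>k \<le> n\<close> by simp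
      then have "subalgebra (G k) (G j)"
        using that \<open>k \<le> n\<close> spG mono by (simp add: subalgebra_def)
      then show ?thesis
        using measurable_from_subalg meas[OF \<open>j \<le> n\<close>] by blast
    qed
    have "{\<omega>\<in>space (G k). 2 * x < \<bar>S k \<omega>\<bar> \<and> (\<forall>j\<in>{..<k}. \<bar>S j \<omega>\<bar> \<le> 2 * x)} \<in> sets (G k)"
    proof (intro sets.sets_Collect_conj sets.sets_Collect_finite_All)
      have [measurable]: "S k \<in> borel_measurable (G k)" by (rule S_G) simp
      show "{\<omega>\<in>space (G k). 2 * x < \<bar>S k \<omega>\<bar>} \<in> sets (G k)" by measurable
      show "{\<omega>\<in>space (G k). \<bar>S j \<omega>\<bar> \<le> 2 * x} \<in> sets (G k)" if "j \<in> {..<k}" for j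
      proof -
        have [measurable]: "S j \<in> borel_measurable (G k)"
          by (rule S_G) (use that in simp)
        show ?thesis by measurable
      qed
    qed simp
    then show ?thesis unfolding A_def spG[OF that] .
  qed
  have A: "A k \<in> events" if "k \<le> n" for k
    using A_G[OF that] sub[OF that] by (auto simp: subalgebra_def)
  have less: "A j \<inter> A k = {}" if "j < k" for j k
  proof -
    have "\<not> 2 * x < \<bar>S j \<omega>\<bar>" if "\<omega> \<in> A k" for \<omega>
      using that \<open>j < k\<close> unfolding A_def by (simp add: not_less)
    then show ?thesis unfolding A_def by blast
  qed
  have disj: "disjoint_family_on A {..n}"
    unfolding disjoint_family_on_def
  proof (intro ballI impI)
    show "A j \<inter> A k = {}" if "j \<noteq> k" for j k
      using less[of j k] less[of k j] that by (cases "j < k") (auto simp: Int_commute)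
  qed
  have union: "{\<omega>\<in>space M. \<exists>k\<le>n. 2 * x < \<bar>S k \<omega>\<bar>} = (\<Union>k\<in>{..n}. A k)"
  proof (intro equalityI subsetI)
    fix \<omega> assume "\<omega> \<in> {\<omega>\<in>space M. \<exists>k\<le>n. 2 * x < \<bar>S k \<omega>\<bar>}"
    then obtain m where m: "\<omega> \<in> space M" "m \<le> n" "2 * x < \<bar>S m \<omega>\<bar>" by blast
    define k where "k = (LEAST k. 2 * x < \<bar>S k \<omega>\<bar>)"
    have "2 * x < \<bar>S k \<omega>\<bar>" using m(3) unfolding k_def by (rule LeastI)
    moreover have "\<bar>S j \<omega>\<bar> \<le> 2 * x" if "j < k" for j
      using not_less_Least[OF that[unfolded k_def]] by simp
    moreover have "k \<le> n"
      using Least_le[of "\<lambda>k. 2 * x < \<bar>S k \<omega>\<bar>" m] m unfolding k_def by simp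
    ultimately show "\<omega> \<in> (\<Union>k\<in>{..n}. A k)" using m(1) unfolding A_def by blast
  next
    fix \<omega> assume "\<omega> \<in> (\<Union>k\<in>{..n}. A k)"
    then show "\<omega> \<in> {\<omega>\<in>space M. \<exists>k\<le>n. 2 * x < \<bar>S k \<omega>\<bar>}"
      unfolding A_def by blast
  qed
  \<comment> \<open>On \<open>B k\<close> the final value exceeds \<open>2 * x - x = x\<close> in
    modulus.\<close>
  define B where "B k = A k \<inter> {\<omega>\<in>space M. \<bar>S n \<omega> - S k \<omega>\<bar> \<le> x}" for k
  have B: "B k \<in> events" if "k \<le> n" for k
  proof -
    have [measurable]: "S k \<in> borel_measurable M" "A k \<in> events" using S A that by auto
    show ?thesis unfolding B_def by measurable
  qed
  have "prob {\<omega>\<in>space M. \<exists>k\<le>n. 2 * x < \<bar>S k \<omega>\<bar>} * (1 - q) = (\<Sum>k\<in>{..n}. prob (A k) * (1 - q))"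
    using finite_measure_finite_Union[OF _ _ disj] A unfolding union
    by (simp add: sum_distrib_right image_subset_iff)
  also have "\<dots> \<le> (\<Sum>k\<in>{..n}. prob (B k))"
  proof (rule sum_mono)
    fix k assume "k \<in> {..n}"
    then have "k \<le> n" by simp
    then show "prob (A k) * (1 - q) \<le> prob (B k)"
      unfolding B_def indep[OF \<open>k \<le> n\<close> A_G[OF \<open>k \<le> n\<close>]] using q by (intro mult_left_mono) auto
  qed
  also have "\<dots> = prob (\<Union>k\<in>{..n}. B k)"
  proof (rule finite_measure_finite_Union[symmetric])
    show "disjoint_family_on B {..n}"
      using disj unfolding disjoint_family_on_def B_def by blast
  qed (use B in auto)
  also have "\<dots> \<le> prob {\<omega>\<in>space M. x < \<bar>S n \<omega>\<bar>}"
  proof (rule finite_measure_mono)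
    show "(\<Union>k\<in>{..n}. B k) \<subseteq> {\<omega>\<in>space M. x < \<bar>S n \<omega>\<bar>}"
    proof
      fix \<omega> assume "\<omega> \<in> (\<Union>k\<in>{..n}. B k)"
      then obtain k where "\<omega> \<in> space M" "2 * x < \<bar>S k \<omega>\<bar>" "\<bar>S n \<omega> - S k \<omega>\<bar> \<le> x"
        unfolding B_def A_def by blast
      moreover from this have "x < \<bar>S n \<omega>\<bar>" by linarith
      ultimately show "\<omega> \<in> {\<omega>\<in>space M. x < \<bar>S n \<omega>\<bar>}" by simp
    qed
  qed measurable
  finally show ?thesis .
qed

section \<open>Passage from dyadic times to right-continuous paths\<close>

context prob_space
begin

context
  fixes F :: "real \<Rightarrow> 'a measure" and Z :: "real \<Rightarrow> 'a \<Rightarrow> real" and t x q :: real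
  assumes t: "0 < t"
    and sub: "\<And>s. 0 \<le> s \<Longrightarrow> s \<le> t \<Longrightarrow> subalgebra M (F s)"
    and mono: "\<And>r s. 0 \<le> r \<Longrightarrow> r \<le> s \<Longrightarrow> s \<le> t \<Longrightarrow> sets (F r) \<subseteq> sets (F s)"
    and meas: "\<And>s. 0 \<le> s \<Longrightarrow> s \<le> t \<Longrightarrow> Z s \<in> borel_measurable (F s)"
    and rc: "\<And>\<omega> s. \<omega> \<in> space M \<Longrightarrow> 0 \<le> s \<Longrightarrow> s < t \<Longrightarrow> ((\<lambda>s. Z s \<omega>) \<longlongrightarrow> Z s \<omega>) (at_right s)"
begin

definition dyadic_exceedance :: "nat \<Rightarrow> 'a set" where
  "dyadic_exceedance n = {\<omega>\<in>space M. \<exists>k\<le>2 ^ n. 2 * x < \<bar>Z (t * real k / 2 ^ n) \<omega>\<bar>}"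

lemma dyadic_time: "k \<le> 2 ^ n \<Longrightarrow> 0 \<le> t * real k / 2 ^ n \<and> t * real k / 2 ^ n \<le> t"
proof -
  assume "k \<le> 2 ^ n"
  then have "real k \<le> 2 ^ n" by (metis of_nat_le_iff of_nat_numeral of_nat_power)
  then show ?thesis using t by (simp add: divide_le_eq)
qed

lemma Z_measurable_M: "0 \<le> s \<Longrightarrow> s \<le> t \<Longrightarrow> Z s \<in> borel_measurable M"
  using measurable_from_subalg[OF sub meas] .

lemma dyadic_exceedance_measurable: "dyadic_exceedance n \<in> events"
proof -
  have "{\<omega>\<in>space M. \<exists>k\<in>{..2 ^ n}. 2 * x < \<bar>Z (t * real k / 2 ^ n) \<omega>\<bar>} \<in> events"
  proof (rule sets.sets_Collect_finite_Ex)
    fix k :: nat assume "k \<in> {..2 ^ n}"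
    then have [measurable]: "Z (t * real k / 2 ^ n) \<in> borel_measurable M"
      using dyadic_time by (intro Z_measurable_M) auto
    show "{\<omega>\<in>space M. 2 * x < \<bar>Z (t * real k / 2 ^ n) \<omega>\<bar>} \<in> events" by measurable
  qed simp
  then show ?thesis unfolding dyadic_exceedance_def atMost_iff Bex_def .
qed

text \<open>Refinement keeps all grid times: index \<open>k\<close> at one level is index
  \<open>2 * k\<close> at the next.\<close>

lemma incseq_dyadic_exceedance: "incseq dyadic_exceedance"
proof (rule incseq_SucI, rule subsetI)
  fix n \<omega> assume "\<omega> \<in> dyadic_exceedance n"
  then obtain k where k: "\<omega> \<in> space M" "k \<le> 2 ^ n" "2 * x < \<bar>Z (t * real k / 2 ^ n) \<omega>\<bar>"
    unfolding dyadic_exceedance_def by blast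
  have "t * real (2 * k) / 2 ^ Suc n = t * real k / 2 ^ n" by simp
  then show "\<omega> \<in> dyadic_exceedance (Suc n)"
    unfolding dyadic_exceedance_def using k by (intro CollectI conjI exI[of _ "2 * k"]) auto
qed

text \<open>By right-continuity a strict exceedance at a time before \<open>t\<close> persists on an
  interval to its right, which contains dyadic times; the endpoint \<open>t\<close> lies on every
  grid. The uncountable union over times thus becomes countable, hence measurable.\<close>

lemma exceedance_eq_Union_dyadic:
  "{\<omega>\<in>space M. \<exists>s\<in>{0..t}. 2 * x < \<bar>Z s \<omega>\<bar>} = (\<Union>n. dyadic_exceedance n)"
proof (intro equalityI subsetI)
  fix \<omega> assume "\<omega> \<in> {\<omega>\<in>space M. \<exists>s\<in>{0..t}. 2 * x < \<bar>Z s \<omega>\<bar>}"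
  then obtain s where \<omega>: "\<omega> \<in> space M" and s: "0 \<le> s" "s \<le> t" "2 * x < \<bar>Z s \<omega>\<bar>" by auto
  show "\<omega> \<in> (\<Union>n. dyadic_exceedance n)"
  proof (cases "s = t")
    case True
    then have "\<omega> \<in> dyadic_exceedance 0"
      unfolding dyadic_exceedance_def using \<omega> s by (intro CollectI conjI exI[of _ 1]) auto
    then show ?thesis by blast
  next
    case False
    then have "s < t" using s by simp
    have "((\<lambda>r. \<bar>Z r \<omega>\<bar>) \<longlongrightarrow> \<bar>Z s \<omega>\<bar>) (at_right s)"
      by (intro tendsto_rabs rc \<omega> s \<open>s < t\<close>)
    then have "\<forall>\<^sub>F r in at_right s. 2 * x < \<bar>Z r \<omega>\<bar>"
      using s(3) by (rule order_tendstoD)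
    then obtain b where b: "s < b" "\<And>r. s < r \<Longrightarrow> r < b \<Longrightarrow> 2 * x < \<bar>Z r \<omega>\<bar>"
      unfolding eventually_at_right_field by blast
    \<comment> \<open>The length, relative to \<open>t\<close>, of the interval after
      \<open>s\<close> on which the exceedance is known to persist. A grid finer than this has a
      point inside.\<close>
    define m where "m = (min b t - s) / t"
    have m: "0 < m" using b(1) \<open>s < t\<close> t by (simp add: m_def)
    then obtain n where n: "(1 / 2) ^ n < m"
      using real_arch_pow_inv[of m "1 / 2"] by auto
    define k where "k = nat \<lfloor>s * 2 ^ n / t\<rfloor> + 1"
    have k_real: "real k = of_int \<lfloor>s * 2 ^ n / t\<rfloor> + 1"
      using s(1) t by (simp add: k_def)
    have "s * 2 ^ n / t < real k" unfolding k_real by linarith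
    then have lower: "s < t * real k / 2 ^ n" using t by (simp add: field_simps)
    have "real k \<le> s * 2 ^ n / t + 1" unfolding k_real by linarith
    then have "t * real k / 2 ^ n \<le> s + t * (1 / 2) ^ n" using t by (simp add: field_simps)
    also have "\<dots> < s + t * m" using n t by simp
    also have "\<dots> = min b t" using t by (simp add: m_def)
    finally have upper: "t * real k / 2 ^ n < min b t" .
    then have "real k < real (2 ^ n)" using t by (simp add: field_simps)
    then have "k \<le> 2 ^ n" by (simp only: of_nat_less_iff)
    moreover have "2 * x < \<bar>Z (t * real k / 2 ^ n) \<omega>\<bar>"
      using lower upper by (intro b(2)) auto
    ultimately have "\<omega> \<in> dyadic_exceedance n"
      unfolding dyadic_exceedance_def using \<omega> by blast
    then show ?thesis by blast
  qed
next
  fix \<omega> assume "\<omega> \<in> (\<Union>n. dyadic_exceedance n)"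
  then obtain n k where "\<omega> \<in> space M" "k \<le> 2 ^ n" "2 * x < \<bar>Z (t * real k / 2 ^ n) \<omega>\<bar>"
    unfolding dyadic_exceedance_def by blast
  then show "\<omega> \<in> {\<omega>\<in>space M. \<exists>s\<in>{0..t}. 2 * x < \<bar>Z s \<omega>\<bar>}"
    using dyadic_time[of k n] by auto
qed

lemma exceedance_measurable: "{\<omega>\<in>space M. \<exists>s\<in>{0..t}. 2 * x < \<bar>Z s \<omega>\<bar>} \<in> events"
  unfolding exceedance_eq_Union_dyadic using dyadic_exceedance_measurable by blast

text \<open>For \<open>q \<le> 1 / 2\<close> the factor \<open>1 - q\<close> is at least
  \<open>1 / 2\<close>, which gives the bound \<open>2 * q\<close> on every dyadic grid, and
  continuity from below carries it to the union. For larger \<open>q\<close> the bound exceeds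
  1.\<close>

lemma ottaviani_right_continuous:
  assumes indep: "\<And>A s. 0 \<le> s \<Longrightarrow> s \<le> t \<Longrightarrow> A \<in> sets (F s) \<Longrightarrow>
      prob (A \<inter> {\<omega>\<in>space M. \<bar>Z t \<omega> - Z s \<omega>\<bar> \<le> x}) = prob A * prob {\<omega>\<in>space M. \<bar>Z t \<omega> - Z s \<omega>\<bar> \<le> x}"
    and incr: "\<And>s. 0 \<le> s \<Longrightarrow> s \<le> t \<Longrightarrow> prob {\<omega>\<in>space M. x < \<bar>Z t \<omega> - Z s \<omega>\<bar>} \<le> q"
    and final: "prob {\<omega>\<in>space M. x < \<bar>Z t \<omega>\<bar>} \<le> q"
  shows "prob {\<omega>\<in>space M. \<exists>s\<in>{0..t}. 2 * x < \<bar>Z s \<omega>\<bar>} \<le> 2 * q"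
proof (cases "q \<le> 1 / 2")
  case True
  have "prob (dyadic_exceedance n) \<le> 2 * q" for n
  proof -
    have ge: "1 - q \<le> prob {\<omega>\<in>space M. \<bar>Z t \<omega> - Z s \<omega>\<bar> \<le> x}" if "0 \<le> s" "s \<le> t" for s
    proof -
      have [measurable]: "Z t \<in> borel_measurable M" "Z s \<in> borel_measurable M"
        using Z_measurable_M that t by auto
      have "{\<omega>\<in>space M. \<bar>Z t \<omega> - Z s \<omega>\<bar> \<le> x} = space M - {\<omega>\<in>space M. x < \<bar>Z t \<omega> - Z s \<omega>\<bar>}"
        by auto
      then have "prob {\<omega>\<in>space M. \<bar>Z t \<omega> - Z s \<omega>\<bar> \<le> x} = 1 - prob {\<omega>\<in>space M. x < \<bar>Z t \<omega> - Z s \<omega>\<bar>}"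
        by (simp add: prob_compl)
      then show ?thesis using incr[OF that] by simp
    qed
    have "prob {\<omega>\<in>space M. \<exists>k\<le>2 ^ n. 2 * x < \<bar>Z (t * real k / 2 ^ n) \<omega>\<bar>} * (1 - q)
      \<le> prob {\<omega>\<in>space M. x < \<bar>Z (t * real (2 ^ n) / 2 ^ n) \<omega>\<bar>}"
    proof (rule ottaviani_discrete[where G = "\<lambda>k. F (t * real k / 2 ^ n)"])
      fix j k :: nat assume "j \<le> k" "k \<le> 2 ^ n"
      then show "sets (F (t * real j / 2 ^ n)) \<subseteq> sets (F (t * real k / 2 ^ n))"
        using t dyadic_time[of k n] by (intro mono) (auto intro!: divide_right_mono)
    next
      fix k :: nat and A
      assume "k \<le> 2 ^ n" "A \<in> sets (F (t * real k / 2 ^ n))"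
      then show "prob (A \<inter> {\<omega>\<in>space M. \<bar>Z (t * real (2 ^ n) / 2 ^ n) \<omega> - Z (t * real k / 2 ^ n) \<omega>\<bar> \<le> x})
        = prob A * prob {\<omega>\<in>space M. \<bar>Z (t * real (2 ^ n) / 2 ^ n) \<omega> - Z (t * real k / 2 ^ n) \<omega>\<bar> \<le> x}"
        using indep[of "t * real k / 2 ^ n" A] dyadic_time[of k n] by simp
    next
      fix k :: nat assume "k \<le> 2 ^ n"
      then have s: "0 \<le> t * real k / 2 ^ n" "t * real k / 2 ^ n \<le> t" using dyadic_time by blast+
      show "subalgebra M (F (t * real k / 2 ^ n))" using sub[OF s] .
      show "Z (t * real k / 2 ^ n) \<in> borel_measurable (F (t * real k / 2 ^ n))" using meas[OF s] .
      show "1 - q \<le> prob {\<omega>\<in>space M. \<bar>Z (t * real (2 ^ n) / 2 ^ n) \<omega> - Z (t * real k / 2 ^ n) \<omega>\<bar> \<le> x}"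
        using ge[OF s] by simp
    qed
    then have *: "prob (dyadic_exceedance n) * (1 - q) \<le> q"
      using final by (simp add: dyadic_exceedance_def)
    have "prob (dyadic_exceedance n) * (1 / 2) \<le> prob (dyadic_exceedance n) * (1 - q)"
      using True by (intro mult_left_mono) auto
    then show ?thesis using * by linarith
  qed
  moreover have "(\<lambda>n. prob (dyadic_exceedance n)) \<longlonglongrightarrow> prob (\<Union>n. dyadic_exceedance n)"
    using dyadic_exceedance_measurable incseq_dyadic_exceedance
    by (intro finite_Lim_measure_incseq) auto
  ultimately show ?thesis
    unfolding exceedance_eq_Union_dyadic by (blast intro: LIMSEQ_le_const2)
next
  case False
  then show ?thesis
    using prob_le_1[of "{\<omega>\<in>space M. \<exists>s\<in>{0..t}. 2 * x < \<bar>Z s \<omega>\<bar>}"] by linarith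
qed

end

end

section \<open>Small-time behaviour of stable processes\<close>

lemma lborel_integral_scaleR:
  fixes f :: "'a::euclidean_space \<Rightarrow> real"
  assumes [measurable]: "f \<in> borel_measurable borel" and "c \<noteq> 0"
  shows "(\<integral>x. f x \<partial>lborel) = \<bar>c\<bar> ^ DIM('a) * (\<integral>x. f (c *\<^sub>R x) \<partial>lborel)"
proof -
  have "(\<integral>x. f x \<partial>lborel) =
    (\<integral>x. f x \<partial>(density (distr lborel borel (\<lambda>x. 0 + c *\<^sub>R x)) (\<lambda>_. \<bar>c\<bar> ^ DIM('a))))"
    using lborel_affine[OF \<open>c \<noteq> 0\<close>, of "0 :: 'a"] by simp
  also have "\<dots> = (\<integral>x. \<bar>c\<bar> ^ DIM('a) *\<^sub>R f x \<partial>(distr lborel borel (\<lambda>x. 0 + c *\<^sub>R x)))"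
    by (rule integral_density) auto
  also have "\<dots> = (\<integral>x. \<bar>c\<bar> ^ DIM('a) *\<^sub>R f (0 + c *\<^sub>R x) \<partial>lborel)"
    by (rule integral_distr) auto
  finally show ?thesis by simp
qed

text \<open>Reflection at the origin preserves \<open>lborel\<close>, so the integral equals its own
  negative.\<close>

lemma lborel_integral_odd:
  fixes f :: "'a::euclidean_space \<Rightarrow> real"
  assumes "f \<in> borel_measurable borel" and "\<And>x. f (- x) = - f x"
  shows "(\<integral>x. f x \<partial>lborel) = 0"
  using lborel_integral_scaleR[OF assms(1), of "- 1"] assms(2) by simp

lemma frac_laplacian_const_nonneg: "0 < \<alpha> \<Longrightarrow> 0 \<le> frac_laplacian_const d \<alpha>"
  unfolding frac_laplacian_const_def
  by (intro divide_nonneg_nonneg mult_nonneg_nonneg order.strict_implies_order[OF Gamma_real_pos]) auto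

definition stable_density :: "real \<Rightarrow> real ^ 'n \<Rightarrow> real" where
  "stable_density \<alpha> z = frac_laplacian_const CARD('n) \<alpha> * norm z powr (- real CARD('n) - \<alpha>)"

lemma stable_density_measurable [measurable]: "stable_density \<alpha> \<in> borel_measurable borel"
  unfolding stable_density_def by measurable

text \<open>If the integrand of the exponent were not integrable, the Bochner integral would be zero and
  \<open>k = 0\<close> would do.\<close>

lemma stable_exponent_bounds:
  fixes e :: "real ^ 'n"
  assumes "0 < \<alpha>"
  obtains K where "0 \<le> K"
    and "\<And>r. 0 < r \<Longrightarrow> \<exists>k. 0 \<le> k \<and> k \<le> K * r powr \<alpha> \<and>
      levy_exponent 0 0 (stable_levy_measure \<alpha>) (r *\<^sub>R e) = - of_real k"
proof
  let ?w = "stable_density \<alpha> :: real ^ 'n \<Rightarrow> real"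
  have w: "0 \<le> ?w z" for z
    using frac_laplacian_const_nonneg[OF assms] by (simp add: stable_density_def)
  \<comment> \<open>Minus the real part of the exponent at \<open>r *\<^sub>R e\<close>, in the case
    of an integrable integrand.\<close>
  define J where "J r = (\<integral>z. ?w z * (1 - cos (r * (e \<bullet> z))) \<partial>lborel)" for r
  have J_nonneg: "0 \<le> J r" for r
    unfolding J_def using w by (intro integral_nonneg_AE AE_I2 mult_nonneg_nonneg) auto
  then show "0 \<le> J 1" .
  \<comment> \<open>Substitute \<open>z / r\<close> for \<open>z\<close>: with d =
    \<open>CARD('n)\<close>, the Jacobian contributes \<open>r\<close> to the power -d and the
    homogeneous density \<open>r\<close> to the power d + \<alpha>.\<close>
  have J_scale: "J r = J 1 * r powr \<alpha>" if "0 < r" for r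
  proof -
    have "J r = \<bar>1 / r\<bar> ^ DIM(real ^ 'n) *
        (\<integral>z. ?w ((1 / r) *\<^sub>R z) * (1 - cos (r * (e \<bullet> (1 / r) *\<^sub>R z))) \<partial>lborel)"
      unfolding J_def using that by (intro lborel_integral_scaleR) auto
    also have "(\<lambda>z. ?w ((1 / r) *\<^sub>R z) * (1 - cos (r * (e \<bullet> (1 / r) *\<^sub>R z)))) =
        (\<lambda>z. r powr (CARD('n) + \<alpha>) * (?w z * (1 - cos (1 * (e \<bullet> z)))))"
    proof
      fix z :: "real ^ 'n"
      have "norm ((1 / r) *\<^sub>R z) powr (- real CARD('n) - \<alpha>)
        = (1 / r) powr (- real CARD('n) - \<alpha>) * norm z powr (- real CARD('n) - \<alpha>)"
        using that by (simp add: powr_mult[symmetric])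
      also have "(1 / r) powr (- real CARD('n) - \<alpha>) = r powr (CARD('n) + \<alpha>)"
        using that powr_minus[of "1 / r" "CARD('n) + \<alpha>"] by (simp add: powr_divide)
      finally show "?w ((1 / r) *\<^sub>R z) * (1 - cos (r * (e \<bullet> (1 / r) *\<^sub>R z))) =
          r powr (CARD('n) + \<alpha>) * (?w z * (1 - cos (1 * (e \<bullet> z))))"
        using that by (simp add: stable_density_def)
    qed
    also have "(\<integral>z. r powr (CARD('n) + \<alpha>) * (?w z * (1 - cos (1 * (e \<bullet> z)))) \<partial>lborel)
        = r powr (CARD('n) + \<alpha>) * J 1"
      unfolding J_def by simp
    also have "\<bar>1 / r\<bar> ^ DIM(real ^ 'n) * (r powr (CARD('n) + \<alpha>) * J 1) = J 1 * r powr \<alpha>"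
      using that by (simp add: powr_add powr_realpow power_divide)
    finally show ?thesis .
  qed
  fix r :: real assume r: "0 < r"
  define f where "f z = cis ((r *\<^sub>R e) \<bullet> z) - 1
    - \<i> * of_real ((r *\<^sub>R e) \<bullet> z) * indicator (cball 0 1) z" for z
  have cis_meas [measurable]: "cis \<in> borel_measurable borel"
    by (intro borel_measurable_continuous_onI continuous_intros)
  have [measurable]: "(indicator (cball 0 1) :: real ^ 'n \<Rightarrow> complex) \<in> borel_measurable borel"
    by (rule borel_measurable_indicator) simp
  have f_meas [measurable]: "f \<in> borel_measurable borel"
    unfolding f_def by measurable
  let ?\<nu> = "stable_levy_measure \<alpha> :: (real ^ 'n) measure"
  have \<nu>: "?\<nu> = density lborel (\<lambda>z. ennreal (?w z))"
    by (simp add: stable_levy_measure_def stable_density_def)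
  have exponent: "levy_exponent 0 0 ?\<nu> (r *\<^sub>R e) = (\<integral>z. f z \<partial>?\<nu>)"
    by (simp add: levy_exponent_def f_def)
  show "\<exists>k. 0 \<le> k \<and> k \<le> J 1 * r powr \<alpha> \<and> levy_exponent 0 0 ?\<nu> (r *\<^sub>R e) = - of_real k"
  proof (cases "integrable ?\<nu> f")
    case True
    have "Re (\<integral>z. f z \<partial>?\<nu>) = (\<integral>z. Re (f z) \<partial>?\<nu>)"
      using True by simp
    also have "\<dots> = (\<integral>z. ?w z *\<^sub>R Re (f z) \<partial>lborel)"
      unfolding \<nu> using w by (intro integral_density) auto
    also have "\<dots> = (\<integral>z. - (?w z * (1 - cos (r * (e \<bullet> z)))) \<partial>lborel)"
      by (intro Bochner_Integration.integral_cong) (auto simp: f_def indicator_def algebra_simps)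
    also have "\<dots> = - J r" unfolding J_def by (rule Bochner_Integration.integral_minus)
    finally have re: "Re (\<integral>z. f z \<partial>?\<nu>) = - J r" .
    have "Im (\<integral>z. f z \<partial>?\<nu>) = (\<integral>z. Im (f z) \<partial>?\<nu>)"
      using True by simp
    also have "\<dots> = (\<integral>z. ?w z *\<^sub>R Im (f z) \<partial>lborel)"
      unfolding \<nu> using w by (intro integral_density) auto
    \<comment> \<open>The imaginary part of the integrand, a sine minus the truncated linear
      compensator, is odd, and the density is even.\<close>
    also have "\<dots> = 0"
      by (rule lborel_integral_odd)
        (measurable, auto simp: f_def stable_density_def indicator_def algebra_simps)
    finally have im: "Im (\<integral>z. f z \<partial>?\<nu>) = 0" .
    have "(\<integral>z. f z \<partial>?\<nu>) = - of_real (J r)"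
      using re im by (simp add: complex_eq_iff)
    then show ?thesis using exponent J_nonneg J_scale[OF r] by (metis order_refl)
  next
    case False
    then have "levy_exponent 0 0 ?\<nu> (r *\<^sub>R e) = - of_real 0"
      unfolding exponent by (simp add: not_integrable_integral_eq)
    then show ?thesis using J_nonneg by (intro exI[of _ 0]) auto
  qed
qed

section \<open>From the exponent to almost sure path bounds\<close>

context
  fixes T \<alpha> :: real and M :: "'w measure" and F :: "real \<Rightarrow> 'w measure"
    and L :: "real \<Rightarrow> 'w \<Rightarrow> real ^ 'n"
  assumes \<alpha>: "0 < \<alpha>" and M: "prob_space M" and filt: "filtration_on T M F"
    and stable: "rot_inv_stable_process \<alpha> T M F L"
begin

interpretation prob_space M by (rule M)

lemma stable_measurable: "0 \<le> s \<Longrightarrow> s \<le> T \<Longrightarrow> L s \<in> borel_measurable (F s)"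
  using stable by (simp add: rot_inv_stable_process_def levy_process_def adapted_on_def)

lemma filtration_subalgebra: "0 \<le> s \<Longrightarrow> s \<le> T \<Longrightarrow> subalgebra M (F s)"
  using filt by (simp add: filtration_on_def)

lemma stable_measurable_M: "0 \<le> s \<Longrightarrow> s \<le> T \<Longrightarrow> L s \<in> borel_measurable M"
  using measurable_from_subalg[OF filtration_subalgebra stable_measurable] .

text \<open>The exponent along \<open>e\<close> is real and equals some \<open>- k\<close> with
  \<open>k \<le> K * u powr \<alpha>\<close>. So the expectation of
  \<open>1 - cos (u * (e \<bullet> L s))\<close> is \<open>1 - exp (- (s * k))\<close>, at most
  \<open>s * k\<close>, and this is linear in \<open>s\<close>. The constant \<open>C\<close> serves
  all \<open>s\<close> and \<open>x\<close>.\<close>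

lemma stable_tail_bound:
  obtains C where "0 \<le> C" and "\<And>s x. 0 \<le> s \<Longrightarrow> s \<le> T \<Longrightarrow> 0 < x \<Longrightarrow>
    prob {\<omega>\<in>space M. x < \<bar>e \<bullet> L s \<omega>\<bar>} \<le> C * s * x powr - \<alpha>"
proof -
  obtain K where K: "0 \<le> K"
    and exponent: "\<And>r. 0 < r \<Longrightarrow> \<exists>k. 0 \<le> k \<and> k \<le> K * r powr \<alpha> \<and>
      levy_exponent 0 0 (stable_levy_measure \<alpha>) (r *\<^sub>R e) = - of_real k"
    using stable_exponent_bounds[OF \<alpha>] by blast
  show ?thesis
  proof
    show "0 \<le> 2 * K * 2 powr \<alpha>" using K by simp
    fix s x :: real assume s: "0 \<le> s" "s \<le> T" and x: "0 < x"
    note [measurable] = stable_measurable_M[OF s]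
    have "prob {\<omega>\<in>space M. x < \<bar>e \<bullet> L s \<omega>\<bar>} \<le> 2 * (s * K) * (2 / x) powr \<alpha>"
    proof (rule tail_bound_from_cos[OF _ _ \<alpha> x])
      fix u :: real assume u: "0 < u"
      obtain k where k: "0 \<le> k" "k \<le> K * u powr \<alpha>"
        "levy_exponent 0 0 (stable_levy_measure \<alpha>) (u *\<^sub>R e) = - of_real k"
        using exponent[OF u] by blast
      have [measurable]: "cis \<in> borel_measurable borel"
        by (intro borel_measurable_continuous_onI continuous_intros)
      have int: "integrable M (\<lambda>\<omega>. cis ((u *\<^sub>R e) \<bullet> L s \<omega>))"
        by (rule integrable_const_bound[of _ 1]) simp_all
      have int_cos: "integrable M (\<lambda>\<omega>. cos (u * (e \<bullet> L s \<omega>)))"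
        by (rule integrable_const_bound[of _ 1]) simp_all
      have "(\<integral>\<omega>. cis ((u *\<^sub>R e) \<bullet> L s \<omega>) \<partial>M)
        = exp (of_real s * levy_exponent 0 0 (stable_levy_measure \<alpha>) (u *\<^sub>R e))"
        using stable s by (simp add: rot_inv_stable_process_def has_levy_triplet_def del: inner_scaleR_left)
      also have "\<dots> = of_real (exp (- (s * k)))"
        by (simp add: k(3) flip: exp_of_real)
      finally have "Re (\<integral>\<omega>. cis ((u *\<^sub>R e) \<bullet> L s \<omega>) \<partial>M) = exp (- (s * k))" by simp
      moreover have "Re (\<integral>\<omega>. cis ((u *\<^sub>R e) \<bullet> L s \<omega>) \<partial>M) = expectation (\<lambda>\<omega>. cos (u * (e \<bullet> L s \<omega>)))"
        using integral_Re[OF int] by simp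
      ultimately have "expectation (\<lambda>\<omega>. 1 - cos (u * (e \<bullet> L s \<omega>))) = 1 - exp (- (s * k))"
        using int_cos by (simp add: prob_space)
      also have "\<dots> \<le> s * k" using exp_ge_add_one_self[of "- (s * k)"] by simp
      also have "\<dots> \<le> s * (K * u powr \<alpha>)" using k s by (intro mult_left_mono) auto
      finally show "expectation (\<lambda>\<omega>. 1 - cos (u * (e \<bullet> L s \<omega>))) \<le> s * K * u powr \<alpha>"
        by (simp add: mult_ac)
    qed (use K s in auto)
    also have "(2 / x) powr \<alpha> = 2 powr \<alpha> * x powr - \<alpha>"
      using x by (simp add: powr_divide powr_minus_divide)
    also have "2 * (s * K) * (2 powr \<alpha> * x powr - \<alpha>) = 2 * K * 2 powr \<alpha> * s * x powr - \<alpha>"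
      by (simp add: mult_ac)
    finally show "prob {\<omega>\<in>space M. x < \<bar>e \<bullet> L s \<omega>\<bar>} \<le> 2 * K * 2 powr \<alpha> * s * x powr - \<alpha>" .
  qed
qed

text \<open>Ottaviani's inequality applies with \<open>q = C * t * x powr - \<alpha>\<close>: an
  increment over \<open>[s, t]\<close> has the law of \<open>L (t - s)\<close>, so its tail is
  controlled by the same estimate, uniformly in \<open>s\<close>.\<close>

lemma stable_exceedance:
  assumes tail: "\<And>s x. 0 \<le> s \<Longrightarrow> s \<le> T \<Longrightarrow> 0 < x \<Longrightarrow>
      prob {\<omega>\<in>space M. x < \<bar>e \<bullet> L s \<omega>\<bar>} \<le> C * s * x powr - \<alpha>"
    and "0 \<le> C" and t: "0 < t" "t \<le> T" and x: "0 < x"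
  shows "{\<omega>\<in>space M. \<exists>s\<in>{0..t}. 2 * x < \<bar>e \<bullet> L s \<omega>\<bar>} \<in> events"
    and "prob {\<omega>\<in>space M. \<exists>s\<in>{0..t}. 2 * x < \<bar>e \<bullet> L s \<omega>\<bar>} \<le> 2 * (C * t * x powr - \<alpha>)"
proof -
  have levy: "levy_process T M F L"
    using stable by (simp add: rot_inv_stable_process_def)
  have sub: "subalgebra M (F s)" if "0 \<le> s" "s \<le> t" for s
    using filtration_subalgebra that t by simp
  have mono: "sets (F r) \<subseteq> sets (F s)" if "0 \<le> r" "r \<le> s" "s \<le> t" for r s
    using filt that t by (simp add: filtration_on_def)
  have meas: "(\<lambda>\<omega>. e \<bullet> L s \<omega>) \<in> borel_measurable (F s)" if "0 \<le> s" "s \<le> t" for s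
    using stable_measurable[of s] that t by simp
  have rc: "((\<lambda>s. e \<bullet> L s \<omega>) \<longlongrightarrow> e \<bullet> L s \<omega>) (at_right s)"
    if "\<omega> \<in> space M" "0 \<le> s" "s < t" for \<omega> s
    using levy that t by (intro tendsto_inner tendsto_const) (simp add: levy_process_def cadlag_on_def)
  show "{\<omega>\<in>space M. \<exists>s\<in>{0..t}. 2 * x < \<bar>e \<bullet> L s \<omega>\<bar>} \<in> events"
    by (rule exceedance_measurable[of t F, OF t(1) sub mono meas rc])
  show "prob {\<omega>\<in>space M. \<exists>s\<in>{0..t}. 2 * x < \<bar>e \<bullet> L s \<omega>\<bar>} \<le> 2 * (C * t * x powr - \<alpha>)"
  proof (rule ottaviani_right_continuous[of t F, OF t(1) sub mono meas rc])
    fix s A assume s: "0 \<le> s" "s \<le> t" and A: "A \<in> sets (F s)"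
    have ind: "indep_set (sets (F s)) (sets (vimage_algebra (space M) (\<lambda>\<omega>. L t \<omega> - L s \<omega>) borel))"
      using levy s t by (simp add: levy_process_def)
    \<comment> \<open>The event is a preimage under the increment, so it belongs to the
      \<sigma>-algebra assumed independent of \<open>F s\<close>.\<close>
    have mem: "(\<lambda>\<omega>. L t \<omega> - L s \<omega>) -` {y. \<bar>e \<bullet> y\<bar> \<le> x} \<inter> space M
        \<in> sets (vimage_algebra (space M) (\<lambda>\<omega>. L t \<omega> - L s \<omega>) borel)"
      by (rule in_vimage_algebra) measurable
    have eq: "(\<lambda>\<omega>. L t \<omega> - L s \<omega>) -` {y. \<bar>e \<bullet> y\<bar> \<le> x} \<inter> space M
        = {\<omega>\<in>space M. \<bar>e \<bullet> L t \<omega> - e \<bullet> L s \<omega>\<bar> \<le> x}"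
      by (auto simp: inner_diff_right)
    show "prob (A \<inter> {\<omega>\<in>space M. \<bar>e \<bullet> L t \<omega> - e \<bullet> L s \<omega>\<bar> \<le> x})
        = prob A * prob {\<omega>\<in>space M. \<bar>e \<bullet> L t \<omega> - e \<bullet> L s \<omega>\<bar> \<le> x}"
      using indep_setD[OF ind A mem] unfolding eq .
  next
    fix s assume s: "0 \<le> s" "s \<le> t"
    have [measurable]: "L t \<in> borel_measurable M" "L s \<in> borel_measurable M"
        "L (t - s) \<in> borel_measurable M"
      using stable_measurable_M s t by auto
    have distr: "distr M borel (\<lambda>\<omega>. L t \<omega> - L s \<omega>) = distr M borel (L (t - s))"
      using levy s t by (simp add: levy_process_def)
    have "prob {\<omega>\<in>space M. x < \<bar>e \<bullet> L t \<omega> - e \<bullet> L s \<omega>\<bar>}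
      = measure (distr M borel (\<lambda>\<omega>. L t \<omega> - L s \<omega>)) {y. x < \<bar>e \<bullet> y\<bar>}"
    proof (subst measure_distr)
      show "prob {\<omega>\<in>space M. x < \<bar>e \<bullet> L t \<omega> - e \<bullet> L s \<omega>\<bar>}
          = prob ((\<lambda>\<omega>. L t \<omega> - L s \<omega>) -` {y. x < \<bar>e \<bullet> y\<bar>} \<inter> space M)"
        by (rule arg_cong[where f = prob]) (auto simp: inner_diff_right)
    qed measurable
    also have "\<dots> = prob {\<omega>\<in>space M. x < \<bar>e \<bullet> L (t - s) \<omega>\<bar>}"
      unfolding distr
    proof (subst measure_distr)
      show "prob (L (t - s) -` {y. x < \<bar>e \<bullet> y\<bar>} \<inter> space M) = prob {\<omega>\<in>space M. x < \<bar>e \<bullet> L (t - s) \<omega>\<bar>}"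
        by (rule arg_cong[where f = prob]) auto
    qed measurable
    also have "\<dots> \<le> C * (t - s) * x powr - \<alpha>"
      using s t x by (intro tail) auto
    also have "\<dots> \<le> C * t * x powr - \<alpha>"
      using s \<open>0 \<le> C\<close> by (intro mult_right_mono mult_left_mono) auto
    finally show "prob {\<omega>\<in>space M. x < \<bar>e \<bullet> L t \<omega> - e \<bullet> L s \<omega>\<bar>} \<le> C * t * x powr - \<alpha>" .
  next
    show "prob {\<omega>\<in>space M. x < \<bar>e \<bullet> L t \<omega>\<bar>} \<le> C * t * x powr - \<alpha>"
      using t x by (intro tail) auto
  qed
qed

text \<open>Along the times \<open>T / 2 ^ n\<close> the probabilities of a large maximum are
  bounded by a geometric sequence exactly because \<open>\<kappa> * \<alpha> < 1\<close>. By
  Borel-Cantelli only finitely many of these events occur, and every small time falls into one of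
  the remaining dyadic blocks.\<close>

lemma stable_small_time:
  assumes T: "0 < T" and \<kappa>: "0 < \<kappa>" "\<kappa> * \<alpha> < 1" and c: "0 < c"
  shows "AE \<omega> in M. \<exists>t0. 0 < t0 \<and> t0 \<le> T \<and> (\<forall>s. 0 < s \<longrightarrow> s \<le> t0 \<longrightarrow> \<bar>e \<bullet> L s \<omega>\<bar> \<le> c * s powr \<kappa>)"
proof -
  obtain C where C: "0 \<le> C" and tail: "\<And>s x. 0 \<le> s \<Longrightarrow> s \<le> T \<Longrightarrow> 0 < x \<Longrightarrow>
      prob {\<omega>\<in>space M. x < \<bar>e \<bullet> L s \<omega>\<bar>} \<le> C * s * x powr - \<alpha>"
    using stable_tail_bound[of e] by blast
  define t where "t n = T / 2 ^ n" for n :: nat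
  \<comment> \<open>\<open>B n\<close> controls the path up to \<open>t n\<close> but is used only
    for times after \<open>t (Suc n)\<close>, hence the shifted index: there \<open>2 * x n\<close>
    is at most \<open>c * s powr \<kappa>\<close>. The half offsets the 2 in the maximal
    inequality.\<close>
  define x where "x n = c / 2 * t (Suc n) powr \<kappa>" for n
  define B where "B n = {\<omega>\<in>space M. \<exists>s\<in>{0..t n}. 2 * x n < \<bar>e \<bullet> L s \<omega>\<bar>}" for n
  have t: "0 < t n" "t n \<le> T" for n using T by (auto simp: t_def divide_le_eq)
  have x: "0 < x n" for n using c t(1)[of "Suc n"] by (simp add: x_def)
  \<comment> \<open>From one level to the next, \<open>t n\<close> is halved while
    \<open>x n powr - \<alpha>\<close> grows by the factor
    \<open>2 powr (\<kappa> * \<alpha>)\<close>; this is the ratio of the bounds.\<close>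
  define \<rho> where "\<rho> = 2 powr (\<kappa> * \<alpha> - 1)"
  have \<rho>: "0 < \<rho>" by (simp add: \<rho>_def)
  have \<rho>1: "\<rho> < 1" unfolding \<rho>_def using \<kappa>(2) by (intro powr_less_one) simp_all
  have q: "2 * (C * t n * x n powr - \<alpha>) = 2 * (C * T * (c / 2 * (T / 2) powr \<kappa>) powr - \<alpha>) * \<rho> ^ n" for n
  proof -
    have "t (Suc n) = T / 2 * 2 powr (- real n)"
      by (simp add: t_def powr_minus_divide powr_realpow)
    then have "t (Suc n) powr \<kappa> = (T / 2) powr \<kappa> * (2 powr (- real n)) powr \<kappa>"
      using T by (simp only: powr_mult)
    then have "x n = (c / 2 * (T / 2) powr \<kappa>) * 2 powr (- (\<kappa> * n))"
      by (simp add: x_def powr_powr mult.commute)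
    then have "x n powr - \<alpha> = (c / 2 * (T / 2) powr \<kappa>) powr - \<alpha> * 2 powr (\<kappa> * \<alpha> * n)"
      using c T by (simp only: powr_mult powr_powr) (simp add: mult_ac)
    moreover have "t n = T * 2 powr (- real n)"
      by (simp add: t_def powr_minus_divide powr_realpow)
    moreover have "\<rho> ^ n = 2 powr (- real n) * 2 powr (\<kappa> * \<alpha> * n)"
    proof -
      have "\<rho> ^ n = \<rho> powr n" using \<rho> by (simp add: powr_realpow)
      also have "\<dots> = 2 powr (- real n + \<kappa> * \<alpha> * n)"
        by (simp add: \<rho>_def powr_powr left_diff_distrib)
      finally show ?thesis by (simp only: powr_add)
    qed
    ultimately show ?thesis by (simp only: mult_ac)
  qed
  have B_events: "B n \<in> events" for n
    unfolding B_def by (rule stable_exceedance(1)[OF tail C t x])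
  have B_prob: "prob (B n) \<le> 2 * (C * T * (c / 2 * (T / 2) powr \<kappa>) powr - \<alpha>) * \<rho> ^ n" for n
    using stable_exceedance(2)[OF tail C t[of n] x[of n]] unfolding B_def q .
  have "summable (\<lambda>n. 2 * (C * T * (c / 2 * (T / 2) powr \<kappa>) powr - \<alpha>) * \<rho> ^ n)"
    using \<rho> \<rho>1 by (intro summable_mult summable_geometric) simp
  then have "summable (\<lambda>n. prob (B n))"
  proof (rule summable_comparison_test'[where N = 0])
    show "norm (prob (B n)) \<le> 2 * (C * T * (c / 2 * (T / 2) powr \<kappa>) powr - \<alpha>) * \<rho> ^ n" for n
      unfolding real_norm_def abs_of_nonneg[OF measure_nonneg] by (rule B_prob)
  qed
  then have "AE \<omega> in M. \<forall>\<^sub>F n in sequentially. \<omega> \<in> space M - B n"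
    using B_events by (intro borel_cantelli_AE1) (auto simp: emeasure_eq_measure)
  then show ?thesis
  proof (rule AE_mp, intro AE_I2 impI)
    fix \<omega> assume "\<omega> \<in> space M" and "\<forall>\<^sub>F n in sequentially. \<omega> \<in> space M - B n"
    then obtain N where N: "\<And>n. N \<le> n \<Longrightarrow> \<omega> \<in> space M - B n"
      unfolding eventually_sequentially by blast
    have "\<bar>e \<bullet> L s \<omega>\<bar> \<le> c * s powr \<kappa>" if s: "0 < s" "s \<le> t N" for s
    proof -
      have "\<exists>m. t m < s"
      proof -
        obtain m where "(1 / 2) ^ m < s / T"
          using real_arch_pow_inv[of "s / T" "1 / 2"] s T by auto
        then show ?thesis using T by (intro exI[of _ m]) (simp add: t_def field_simps)
      qed
      \<comment> \<open>The least such index locates \<open>s\<close> in its dyadic block: after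
        \<open>t m\<close>, but not after the preceding grid time.\<close>
      then obtain m where m: "t m < s" "\<And>j. j < m \<Longrightarrow> \<not> t j < s"
        by (meson exists_least_iff)
      have "N < m"
      proof (rule ccontr)
        assume "\<not> N < m"
        then have "t N \<le> t m" using T by (auto simp: t_def intro!: divide_left_mono power_increasing)
        then show False using m(1) s by simp
      qed
      then obtain n where n: "m = Suc n" "N \<le> n" by (cases m) auto
      have "\<bar>e \<bullet> L s \<omega>\<bar> \<le> 2 * x n"
        using N[OF n(2)] m(2)[of n] n(1) s by (force simp: B_def not_less)
      also have "\<dots> = c * t m powr \<kappa>" by (simp add: x_def n)
      also have "\<dots> \<le> c * s powr \<kappa>"
        using m(1) t(1)[of m] c \<kappa> by (intro mult_left_mono powr_mono2) auto
      finally show ?thesis .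
    qed
    then show "\<exists>t0. 0 < t0 \<and> t0 \<le> T \<and> (\<forall>s. 0 < s \<longrightarrow> s \<le> t0 \<longrightarrow> \<bar>e \<bullet> L s \<omega>\<bar> \<le> c * s powr \<kappa>)"
      using t by blast
  qed
qed

end

section \<open>The drift and the extremal solutions\<close>

text \<open>At time 0 the drift vanishes, as \<open>0 powr - \<gamma> = 0\<close>. It is therefore a
  bounded Hoelder function of \<open>x\<close> at every time, including the singular one.\<close>

definition ray_drift :: "real \<Rightarrow> real \<Rightarrow> 'a::euclidean_space \<Rightarrow> real \<Rightarrow> 'a \<Rightarrow> 'a" where
  "ray_drift \<gamma> \<beta> e t x = (t powr - \<gamma> * signed_powr \<beta> (e \<bullet> x)) *\<^sub>R e"

context
  fixes \<gamma> \<beta> :: real and e :: "'a::euclidean_space"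
  assumes \<beta>: "0 < \<beta>" "\<beta> \<le> 1" and e: "norm e = 1"
begin

lemma norm_ray_drift_le: "norm (ray_drift \<gamma> \<beta> e t x) \<le> t powr - \<gamma>"
  using abs_signed_powr_le_1[OF \<beta>(1)] e by (simp add: ray_drift_def abs_mult mult_left_le)

text \<open>Projection onto the unit vector \<open>e\<close> is 1-Lipschitz by Cauchy-Schwarz, so
  the Hoelder bound of \<open>signed_powr\<close> carries over with its constant 2.\<close>

lemma ray_drift_quotient_le:
  assumes "q \<in> holder_quotients \<beta> (ray_drift \<gamma> \<beta> e t)"
  shows "q \<le> 2 * t powr - \<gamma>"
proof -
  obtain x y where q: "q = norm (ray_drift \<gamma> \<beta> e t x - ray_drift \<gamma> \<beta> e t y) / norm (x - y) powr \<beta>"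
    and "x \<noteq> y"
    using assms unfolding holder_quotients_def by blast
  have "\<bar>e \<bullet> x - e \<bullet> y\<bar> \<le> norm (x - y)"
    using Cauchy_Schwarz_ineq2[of e "x - y"] e by (simp add: inner_diff_right)
  then have "\<bar>e \<bullet> x - e \<bullet> y\<bar> powr \<beta> \<le> norm (x - y) powr \<beta>"
    using \<beta> by (intro powr_mono2) auto
  then have "\<bar>signed_powr \<beta> (e \<bullet> x) - signed_powr \<beta> (e \<bullet> y)\<bar> \<le> 2 * norm (x - y) powr \<beta>"
    using signed_powr_holder[OF \<beta>, of "e \<bullet> x" "e \<bullet> y"] by linarith
  then have "t powr - \<gamma> * \<bar>signed_powr \<beta> (e \<bullet> x) - signed_powr \<beta> (e \<bullet> y)\<bar>
    \<le> t powr - \<gamma> * (2 * norm (x - y) powr \<beta>)"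
    by (intro mult_left_mono) auto
  moreover have "norm (ray_drift \<gamma> \<beta> e t x - ray_drift \<gamma> \<beta> e t y)
    = t powr - \<gamma> * \<bar>signed_powr \<beta> (e \<bullet> x) - signed_powr \<beta> (e \<bullet> y)\<bar>"
    using e by (simp add: ray_drift_def abs_mult flip: scaleR_left_diff_distrib right_diff_distrib)
  ultimately show ?thesis
    using \<open>x \<noteq> y\<close> unfolding q by (simp add: pos_divide_le_eq mult_ac)
qed

lemma ray_drift_in_holder_space: "ray_drift \<gamma> \<beta> e t \<in> holder_space \<beta>"
proof -
  have "bounded (range (ray_drift \<gamma> \<beta> e t))"
    using norm_ray_drift_le by (auto simp: bounded_iff)
  moreover have "bdd_above (holder_quotients \<beta> (ray_drift \<gamma> \<beta> e t))"
    using ray_drift_quotient_le by (rule bdd_aboveI)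
  ultimately show ?thesis by (simp add: holder_space_def)
qed

lemma sup_norm_ray_drift: "0 \<le> sup_norm (ray_drift \<gamma> \<beta> e t)" "sup_norm (ray_drift \<gamma> \<beta> e t) \<le> t powr - \<gamma>"
proof -
  have "bdd_above (range (\<lambda>x. norm (ray_drift \<gamma> \<beta> e t x)))"
    using norm_ray_drift_le by (auto simp: bdd_above_def)
  then show "0 \<le> sup_norm (ray_drift \<gamma> \<beta> e t)"
    unfolding sup_norm_def by (intro cSUP_upper2[of _ _ 0]) auto
  show "sup_norm (ray_drift \<gamma> \<beta> e t) \<le> t powr - \<gamma>"
    unfolding sup_norm_def using norm_ray_drift_le by (intro cSUP_least) auto
qed

lemma holder_seminorm_ray_drift:
  "0 \<le> holder_seminorm \<beta> (ray_drift \<gamma> \<beta> e t)"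
  "holder_seminorm \<beta> (ray_drift \<gamma> \<beta> e t) \<le> 2 * t powr - \<gamma>"
proof -
  have "e \<noteq> 0" using e by auto
  \<comment> \<open>An explicit quotient, from the points \<open>e\<close> and \<open>0\<close>: it
    shows that the supremum is taken over a nonempty set and is nonnegative.\<close>
  define q where "q = norm (ray_drift \<gamma> \<beta> e t e - ray_drift \<gamma> \<beta> e t 0) / norm (e - 0) powr \<beta>"
  have q: "q \<in> holder_quotients \<beta> (ray_drift \<gamma> \<beta> e t)"
    unfolding holder_quotients_def q_def using \<open>e \<noteq> 0\<close> by blast
  have "bdd_above (holder_quotients \<beta> (ray_drift \<gamma> \<beta> e t))"
    using ray_drift_quotient_le by (auto simp: bdd_above_def)
  with q have "q \<le> holder_seminorm \<beta> (ray_drift \<gamma> \<beta> e t)"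
    unfolding holder_seminorm_def by (intro cSup_upper)
  moreover have "0 \<le> q" by (simp add: q_def)
  ultimately show "0 \<le> holder_seminorm \<beta> (ray_drift \<gamma> \<beta> e t)" by simp
  show "holder_seminorm \<beta> (ray_drift \<gamma> \<beta> e t) \<le> 2 * t powr - \<gamma>"
    unfolding holder_seminorm_def using q ray_drift_quotient_le by (intro cSup_least) auto
qed

text \<open>Both norms are at most a constant times \<open>t powr - \<gamma>\<close>, whose
  \<open>p\<close>-th power is integrable at 0 because \<open>\<gamma> * p < 1\<close>. One estimate
  serves both, with constant 1 for the supremum and 2 for the seminorm.\<close>

lemma ray_drift_in_Lp_holder:
  assumes "0 < T" "0 < p" "\<gamma> * p < 1"
  shows "ray_drift \<gamma> \<beta> e \<in> Lp_holder T p \<beta>"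
proof -
  have bound: "(\<integral>\<^sup>+t\<in>{0..T}. ennreal (N t powr p) \<partial>lborel) < \<infinity>"
    if N: "\<And>t. 0 \<le> N t" "\<And>t. N t \<le> C * t powr - \<gamma>" and "0 \<le> C" for N :: "real \<Rightarrow> real" and C
  proof -
    have "(\<integral>\<^sup>+t\<in>{0..T}. ennreal (N t powr p) \<partial>lborel)
      \<le> (\<integral>\<^sup>+t. ennreal (C powr p) * ennreal (indicator {0..T} t * t powr - (\<gamma> * p)) \<partial>lborel)"
    proof (rule nn_integral_mono)
      fix t :: real
      have "N t powr p \<le> (C * t powr - \<gamma>) powr p"
        using N assms by (intro powr_mono2) auto
      also have "\<dots> = C powr p * t powr - (\<gamma> * p)"
        using \<open>0 \<le> C\<close> by (simp add: powr_mult powr_powr)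
      finally show "ennreal (N t powr p) * indicator {0..T} t
        \<le> ennreal (C powr p) * ennreal (indicator {0..T} t * t powr - (\<gamma> * p))"
        by (auto simp: indicator_def ennreal_mult[symmetric] intro!: ennreal_leI)
    qed
    also have "\<dots> = ennreal (C powr p) * ennreal (T powr (- (\<gamma> * p) + 1) / (- (\<gamma> * p) + 1))"
      using assms by (subst nn_integral_cmult) (auto simp: nn_integral_powr_from_0)
    also have "\<dots> < \<infinity>" by (simp add: ennreal_mult_less_top)
    finally show ?thesis .
  qed
  have "(\<lambda>(t, x). ray_drift \<gamma> \<beta> e t x) \<in> borel_measurable (borel \<Otimes>\<^sub>M borel)"
    unfolding ray_drift_def by measurable
  then have "(\<lambda>(t, x). ray_drift \<gamma> \<beta> e t x) \<in> borel_measurable (restrict_space borel ({0..T} \<times> UNIV))"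
    unfolding borel_prod by (rule measurable_restrict_space1)
  then show ?thesis
    using bound[of "\<lambda>t. sup_norm (ray_drift \<gamma> \<beta> e t)" 1] sup_norm_ray_drift
      bound[of "\<lambda>t. holder_seminorm \<beta> (ray_drift \<gamma> \<beta> e t)" 2] holder_seminorm_ray_drift
      ray_drift_in_holder_space
    unfolding Lp_holder_def by auto
qed

end

lemma cadlag_clamp_right_continuous:
  fixes f :: "real \<Rightarrow> 'a::topological_space"
  assumes "cadlag_on T f" "0 < T"
  shows "((\<lambda>s. f (max 0 (min s T))) \<longlongrightarrow> f (max 0 (min s T))) (at_right s)"
proof -
  consider "s < 0" | "0 \<le> s" "s < T" | "T \<le> s" by linarith
  then show ?thesis
  proof cases
    case 1
    then have "\<forall>\<^sub>F r in at_right s. r < 0" by (auto simp: eventually_at_right_field)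
    then have "\<forall>\<^sub>F r in at_right s. f (max 0 (min r T)) = f (max 0 (min s T))"
      by eventually_elim (use 1 \<open>0 < T\<close> in \<open>simp add: max_def min_def\<close>)
    then show ?thesis by (rule tendsto_eventually)
  next
    case 2
    then have lim: "(f \<longlongrightarrow> f s) (at_right s)" using assms by (simp add: cadlag_on_def)
    have "\<forall>\<^sub>F r in at_right s. s < r \<and> r < T" using 2 by (auto simp: eventually_at_right_field)
    then have "\<forall>\<^sub>F r in at_right s. f r = f (max 0 (min r T))"
      by eventually_elim (use 2 in \<open>simp add: max_def min_def\<close>)
    from Lim_transform_eventually[OF lim this] show ?thesis using 2 by (simp add: max_def min_def)
  next
    case 3
    have "\<forall>\<^sub>F r in at_right s. s < r" by (auto simp: eventually_at_right_field intro: exI[of _ "s + 1"])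
    then have "\<forall>\<^sub>F r in at_right s. f (max 0 (min r T)) = f (max 0 (min s T))"
      by eventually_elim (use 3 \<open>0 < T\<close> in \<open>simp add: min_absorb2\<close>)
    then show ?thesis by (rule tendsto_eventually)
  qed
qed

text \<open>The sign \<open>\<sigma> = 1\<close> gives the upper branch. For
  \<open>\<sigma> = - 1\<close> the noise is reflected, the upper branch is built for the reflected
  noise, and the result is reflected back, which yields the lower branch.\<close>

definition extremal_solution ::
  "real \<Rightarrow> real \<Rightarrow> 'a::euclidean_space \<Rightarrow> real \<Rightarrow> (real \<Rightarrow> 'w \<Rightarrow> 'a) \<Rightarrow> real \<Rightarrow> real \<Rightarrow> 'w \<Rightarrow> 'a" where
  "extremal_solution \<gamma> \<beta> e T L \<sigma> t \<omega> =
     (\<sigma> * max_drift \<gamma> \<beta> (\<lambda>s. \<sigma> * (e \<bullet> L (max 0 (min s T)) \<omega>)) t) *\<^sub>R e + L t \<omega>"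

text \<open>The component along \<open>e\<close> is \<sigma> times the fixed point plus its noise.
  As \<open>signed_powr\<close> is odd, \<sigma> passes through it, and the scalar fixed-point
  equation becomes the equation for either sign; orthogonally to \<open>e\<close> only the noise
  acts.\<close>

lemma sde_solution_extremal_solution:
  fixes e :: "'a::euclidean_space"
  assumes \<gamma>: "\<gamma> < 1" and \<beta>: "0 < \<beta>" and e: "norm e = 1" and T: "0 < T" and \<sigma>: "\<sigma> = 1 \<or> \<sigma> = - 1"
    and filt: "filtration_on T M F" and adapt: "adapted_on T F L"
    and cadlag: "\<And>\<omega>. \<omega> \<in> space M \<Longrightarrow> cadlag_on T (\<lambda>t. L t \<omega>)"
  shows "sde_solution T M F L 0 (ray_drift \<gamma> \<beta> e) (extremal_solution \<gamma> \<beta> e T L \<sigma>)"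
proof -
  define Z where "Z s \<omega> = \<sigma> * (e \<bullet> L (max 0 (min s T)) \<omega>)" for s \<omega>
  define U where "U \<omega> = max_drift \<gamma> \<beta> (\<lambda>s. Z s \<omega>)" for \<omega>
  have X: "extremal_solution \<gamma> \<beta> e T L \<sigma> t \<omega> = (\<sigma> * U \<omega> t) *\<^sub>R e + L t \<omega>" for t \<omega>
    by (simp add: extremal_solution_def U_def Z_def)
  have Z_rc: "((\<lambda>s. Z s \<omega>) \<longlongrightarrow> Z s \<omega>) (at_right s)" if "\<omega> \<in> space M" for s \<omega>
    unfolding Z_def
    by (intro tendsto_intros cadlag_clamp_right_continuous[OF cadlag[OF that] T])
  have Z_borel: "(\<lambda>s. Z s \<omega>) \<in> borel_measurable borel" if "\<omega> \<in> space M" for \<omega>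
    by (rule borel_measurable_right_continuous[OF Z_rc[OF that]])
  have U_cont: "continuous_on UNIV (U \<omega>)" if "\<omega> \<in> space M" for \<omega>
    unfolding U_def by (rule max_drift_continuous[OF \<gamma> \<beta> Z_borel[OF that]])
  have U_tendsto: "(U \<omega> \<longlongrightarrow> U \<omega> t) (at t within S)" if "\<omega> \<in> space M" for \<omega> t S
    using U_cont[OF that] unfolding continuous_on_def by (blast intro: tendsto_within_subset)
  have "adapted_on T F (extremal_solution \<gamma> \<beta> e T L \<sigma>)"
    unfolding adapted_on_def
  proof
    fix t assume t: "t \<in> {0..T}"
    have sp: "space (F t) = space M" using filt t by (simp add: filtration_on_def subalgebra_def)
    have L_meas: "L s \<in> borel_measurable (F t)" if "0 \<le> s" "s \<le> t" for s
    proof -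
      have "subalgebra (F t) (F s)"
        using filt t that by (simp add: filtration_on_def subalgebra_def)
      moreover have "L s \<in> borel_measurable (F s)"
        using adapt t that by (simp add: adapted_on_def)
      ultimately show ?thesis by (rule measurable_from_subalg)
    qed
    have "(\<lambda>\<omega>. U \<omega> t) \<in> borel_measurable (F t)"
      unfolding U_def
    proof (rule max_drift_adapted[OF \<gamma> \<beta>])
      show "((\<lambda>s. Z s \<omega>) \<longlongrightarrow> Z s \<omega>) (at_right s)" if "\<omega> \<in> space (F t)" for s \<omega>
        using Z_rc that sp by simp
      \<comment> \<open>For \<open>s \<le> t \<le> T\<close> the clamped time lies in
        \<open>{0..t}\<close>, negative \<open>s\<close> being sent to 0.\<close>
      show "Z s \<in> borel_measurable (F t)" if "s \<le> t" for s
        unfolding Z_def using t that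
        by (intro borel_measurable_times borel_measurable_inner borel_measurable_const L_meas) auto
    qed
    moreover have "L t \<in> borel_measurable (F t)" using L_meas t by simp
    ultimately show "extremal_solution \<gamma> \<beta> e T L \<sigma> t \<in> borel_measurable (F t)"
      unfolding X[abs_def] by measurable
  qed
  moreover have "cadlag_on T (\<lambda>t. extremal_solution \<gamma> \<beta> e T L \<sigma> t \<omega>)" if \<omega>: "\<omega> \<in> space M" for \<omega>
    unfolding cadlag_on_def X
  proof (intro conjI ballI)
    fix t assume "t \<in> {0..<T}"
    then have "((\<lambda>t. L t \<omega>) \<longlongrightarrow> L t \<omega>) (at_right t)"
      using cadlag[OF \<omega>] by (simp add: cadlag_on_def)
    then show "((\<lambda>t. (\<sigma> * U \<omega> t) *\<^sub>R e + L t \<omega>) \<longlongrightarrow> (\<sigma> * U \<omega> t) *\<^sub>R e + L t \<omega>) (at_right t)"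
      by (intro tendsto_intros U_tendsto \<omega>)
  next
    fix t assume "t \<in> {0<..T}"
    then obtain l where "((\<lambda>t. L t \<omega>) \<longlongrightarrow> l) (at_left t)"
      using cadlag[OF \<omega>] unfolding cadlag_on_def by blast
    then have "((\<lambda>t. (\<sigma> * U \<omega> t) *\<^sub>R e + L t \<omega>) \<longlongrightarrow> (\<sigma> * U \<omega> t) *\<^sub>R e + l) (at_left t)"
      by (intro tendsto_intros U_tendsto \<omega>)
    then show "\<exists>l. ((\<lambda>t. (\<sigma> * U \<omega> t) *\<^sub>R e + L t \<omega>) \<longlongrightarrow> l) (at_left t)" by blast
  qed
  moreover have "set_integrable lborel {0..T} (\<lambda>s. ray_drift \<gamma> \<beta> e s (extremal_solution \<gamma> \<beta> e T L \<sigma> s \<omega>)) \<and>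
      (\<forall>t\<in>{0..T}. extremal_solution \<gamma> \<beta> e T L \<sigma> t \<omega> =
        0 + (LINT s:{0..t}|lborel. ray_drift \<gamma> \<beta> e s (extremal_solution \<gamma> \<beta> e T L \<sigma> s \<omega>)) + L t \<omega>)"
    if \<omega>: "\<omega> \<in> space M" for \<omega>
  proof -
    let ?g = "\<lambda>s. s powr - \<gamma> * signed_powr \<beta> (U \<omega> s + Z s \<omega>)"
    note [measurable] = Z_borel[OF \<omega>]
    have [measurable]: "U \<omega> \<in> borel_measurable borel"
      using U_cont[OF \<omega>] by (rule borel_measurable_continuous_onI)
    have drift: "ray_drift \<gamma> \<beta> e s (extremal_solution \<gamma> \<beta> e T L \<sigma> s \<omega>) = (\<sigma> * ?g s) *\<^sub>R e"
      if "s \<in> {0..T}" for s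
    proof -
      have "e \<bullet> e = 1" using e by (simp add: dot_square_norm)
      moreover have "max 0 (min s T) = s" using that by (auto simp: max_def min_def)
      ultimately have "e \<bullet> extremal_solution \<gamma> \<beta> e T L \<sigma> s \<omega> = \<sigma> * (U \<omega> s + Z s \<omega>)"
        using \<sigma> by (auto simp: X Z_def inner_add_right)
      moreover have "signed_powr \<beta> (\<sigma> * (U \<omega> s + Z s \<omega>)) = \<sigma> * signed_powr \<beta> (U \<omega> s + Z s \<omega>)"
        using \<sigma> signed_powr_minus[of \<beta> "U \<omega> s + Z s \<omega>"] by auto
      ultimately show ?thesis by (simp add: ray_drift_def)
    qed
    have int: "set_integrable lborel {0..t} ?g" for t
      by (intro set_integrable_weighted[OF \<gamma>] abs_signed_powr_le_1[OF \<beta>]) measurable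
    have "set_integrable lborel {0..T} (\<lambda>s. (\<sigma> * ?g s) *\<^sub>R e)"
      by (intro set_integrable_scaleR_left set_integrable_mult_right int)
    moreover have "set_integrable lborel {0..T} (\<lambda>s. (\<sigma> * ?g s) *\<^sub>R e) =
        set_integrable lborel {0..T} (\<lambda>s. ray_drift \<gamma> \<beta> e s (extremal_solution \<gamma> \<beta> e T L \<sigma> s \<omega>))"
      by (rule set_integrable_cong) (auto simp: drift)
    moreover have "(LINT s:{0..t}|lborel. ray_drift \<gamma> \<beta> e s (extremal_solution \<gamma> \<beta> e T L \<sigma> s \<omega>))
        = (\<sigma> * U \<omega> t) *\<^sub>R e" if "t \<in> {0..T}" for t
    proof -
      have "(LINT s:{0..t}|lborel. ray_drift \<gamma> \<beta> e s (extremal_solution \<gamma> \<beta> e T L \<sigma> s \<omega>))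
        = (LINT s:{0..t}|lborel. (\<sigma> * ?g s) *\<^sub>R e)"
        using that by (intro set_lebesgue_integral_cong) (auto simp: drift)
      also have "\<dots> = (LINT s:{0..t}|lborel. \<sigma> * ?g s) *\<^sub>R e"
      proof -
        have "integrable lborel (\<lambda>s. indicator {0..t} s *\<^sub>R (\<sigma> * ?g s))"
          unfolding set_integrable_def[symmetric] by (intro set_integrable_mult_right int)
        then have "(LINT s|lborel. (indicator {0..t} s *\<^sub>R (\<sigma> * ?g s)) *\<^sub>R e)
            = (LINT s|lborel. indicator {0..t} s *\<^sub>R (\<sigma> * ?g s)) *\<^sub>R e"
          by (intro integral_scaleR_left)
        then show ?thesis
          unfolding set_lebesgue_integral_def by (simp only: real_scaleR_def scaleR_scaleR mult.assoc)
      qed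
      also have "(LINT s:{0..t}|lborel. \<sigma> * ?g s) = \<sigma> * U \<omega> t"
      proof -
        have "U \<omega> t = (LINT s:{0..t}|lborel. ?g s)"
          using max_drift_fixed_point[OF \<gamma> \<beta> Z_borel[OF \<omega>], of t]
          unfolding U_def weighted_integral_def .
        then show ?thesis by simp
      qed
      finally show ?thesis .
    qed
    ultimately show ?thesis by (simp add: X)
  qed
  ultimately show ?thesis
    unfolding sde_solution_def by (intro conjI ballI AE_I2) blast+
qed

section \<open>Non-uniqueness\<close>

lemma powr_eventually_small:
  fixes a c :: real
  assumes "0 < a" "0 < c"
  obtains t1 where "0 < t1" "\<And>t. 0 < t \<Longrightarrow> t \<le> t1 \<Longrightarrow> c * t powr a \<le> 1"
proof
  show "0 < (1 / c) powr (1 / a)" using assms by simp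
  fix t :: real assume "0 < t" "t \<le> (1 / c) powr (1 / a)"
  then have "t powr a \<le> ((1 / c) powr (1 / a)) powr a"
    using assms by (intro powr_mono2) auto
  also have "\<dots> = 1 / c" using assms by (simp add: powr_powr)
  finally show "c * t powr a \<le> 1" using assms by (simp add: pos_le_divide_eq mult.commute)
qed

text \<open>The constants \<open>c\<close> and \<open>t1\<close> depend only on \<gamma> and
  \<beta>, not on the path. This matters because \<open>c\<close> must be fixed before the almost
  sure smallness of the noise is invoked, whereas the horizon \<open>t0\<close> may vary with the
  path.\<close>

lemma max_drift_growth:
  assumes \<gamma>: "\<gamma> < 1" and \<beta>: "0 < \<beta>" "\<beta> < 1" and \<kappa>: "\<kappa> = (1 - \<gamma>) / (1 - \<beta>)"
  obtains c t1 where "0 < c" "0 < t1"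
    and "\<And>l t t0. l \<in> borel_measurable borel \<Longrightarrow>
      (\<And>s. 0 < s \<Longrightarrow> s \<le> t0 \<Longrightarrow> \<bar>l s\<bar> \<le> c / 2 * s powr \<kappa>) \<Longrightarrow> 0 < t \<Longrightarrow> t \<le> t0 \<Longrightarrow> t0 \<le> t1 \<Longrightarrow>
      c * t powr \<kappa> \<le> max_drift \<gamma> \<beta> l t"
proof -
  have \<kappa>pos: "0 < \<kappa>" using \<kappa> \<gamma> \<beta> by simp
  have "\<kappa> - (1 - \<gamma>) = \<kappa> * \<beta>" using \<kappa> \<beta> by (simp add: field_simps)
  then have \<kappa>': "0 < \<kappa> - (1 - \<gamma>)" using \<kappa>pos \<beta> by simp
  \<comment> \<open>The solution of \<open>c = (c / 2) powr \<beta> / \<kappa>\<close>, the equality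
    case of the condition on \<open>c\<close> for the lower barrier.\<close>
  define c where "c = (2 powr - \<beta> / \<kappa>) powr (1 / (1 - \<beta>))"
  have c: "0 < c" using \<kappa>pos by (simp add: c_def)
  have "c powr (1 - \<beta>) = 2 powr - \<beta> / \<kappa>"
    unfolding c_def using \<kappa>pos \<beta> by (simp add: powr_powr)
  then have "c powr \<beta> * (2 powr - \<beta> / \<kappa>) = c powr \<beta> * c powr (1 - \<beta>)" by simp
  also have "\<dots> = c" using c by (simp flip: powr_add)
  finally have c_eq: "c \<le> (c / 2) powr \<beta> / \<kappa>"
    using c by (simp add: powr_divide powr_minus_divide)
  obtain t2 where t2: "0 < t2" "\<And>t. 0 < t \<Longrightarrow> t \<le> t2 \<Longrightarrow> c * t powr \<kappa> \<le> 1"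
    using powr_eventually_small[OF \<kappa>pos c] by blast
  have "0 < c * (1 - \<gamma>)" using c \<gamma> by simp
  then obtain t3 where t3: "0 < t3"
      "\<And>t. 0 < t \<Longrightarrow> t \<le> t3 \<Longrightarrow> c * (1 - \<gamma>) * t powr (\<kappa> - (1 - \<gamma>)) \<le> 1"
    using powr_eventually_small[OF \<kappa>'] by blast
  show ?thesis
  proof
    show "0 < c" "0 < min t2 t3" using c t2 t3 by auto
    fix l t t0
    assume l: "l \<in> borel_measurable borel"
      and small: "\<And>s. 0 < s \<Longrightarrow> s \<le> t0 \<Longrightarrow> \<bar>l s\<bar> \<le> c / 2 * s powr \<kappa>"
      and t: "0 < t" "t \<le> t0" "t0 \<le> min t2 t3"
    show "c * t powr \<kappa> \<le> max_drift \<gamma> \<beta> l t"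
    proof (rule max_drift_lower[OF \<gamma> \<beta>(1) l \<beta>(2) \<kappa> c c_eq _ _ _ t(1,2)])
      show "c * t0 powr \<kappa> \<le> 1" using t2(2)[of t0] t by simp
      show "c * t0 powr (\<kappa> - (1 - \<gamma>)) * (1 - \<gamma>) \<le> 1"
        using t3(2)[of t0] t by (simp add: mult_ac)
      show "- (c / 2) * s powr \<kappa> \<le> l s" if "0 < s" "s \<le> t0" for s
        using small[OF that] by (simp add: abs_le_iff)
    qed
  qed
qed

theorem theorem1p3:
  fixes T \<alpha> \<beta> p :: real
    and M :: "'w measure"
    and F :: "real \<Rightarrow> 'w measure"
    and L :: "real \<Rightarrow> 'w \<Rightarrow> real ^ 'n"
  assumes "0 < T" and "0 < \<alpha>" and "\<alpha> < 2"
    and "prob_space M" and "filtration_on T M F" and "usual_hypotheses T M F"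
    and "rot_inv_stable_process \<alpha> T M F L"
    and "max 0 (1 - \<alpha>) < \<beta>" and "\<beta> < 1"
    and "1 \<le> p" and "p < \<alpha> / (\<alpha> + \<beta> - 1)"
  shows "\<exists>(x :: real ^ 'n) (b :: real \<Rightarrow> real ^ 'n \<Rightarrow> real ^ 'n). b \<in> Lp_holder T p \<beta> \<and>
    (\<exists>X Y. sde_solution T M F L x b X \<and> sde_solution T M F L x b Y \<and>
       \<not> indistinguishable_on T M X Y)"
proof -
  interpret prob_space M by fact
  have \<beta>: "0 < \<beta>" "\<beta> < 1" "\<beta> \<le> 1" and sum: "0 < \<alpha> + \<beta> - 1" using assms(8,9) by auto
  \<comment> \<open>The upper bound on \<open>p\<close> says that there is room for
    \<gamma>.\<close>
  have "(\<alpha> + \<beta> - 1) / \<alpha> < 1 / p"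
    using assms(2,10,11) sum by (simp add: field_simps)
  then obtain \<gamma> where \<gamma>: "(\<alpha> + \<beta> - 1) / \<alpha> < \<gamma>" "\<gamma> < 1 / p" using dense by blast
  have "1 / p \<le> 1" using assms(10) by simp
  with \<gamma> have \<gamma>1: "\<gamma> < 1" by linarith
  have \<gamma>p: "\<gamma> * p < 1" using \<gamma>(2) assms(10) by (simp add: field_simps)
  define \<kappa> where "\<kappa> = (1 - \<gamma>) / (1 - \<beta>)"
  have \<kappa>: "0 < \<kappa>" using \<gamma>1 \<beta> by (simp add: \<kappa>_def)
  \<comment> \<open>The lower bound on \<gamma>, rearranged to compare \<kappa> with
    \<open>1 / \<alpha>\<close>.\<close>
  have "(1 - \<gamma>) * \<alpha> < 1 - \<beta>" using \<gamma>(1) assms(2) by (simp add: field_simps)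
  then have \<kappa>\<alpha>: "\<kappa> * \<alpha> < 1" using \<beta> by (simp add: \<kappa>_def divide_less_eq)
  obtain e :: "real ^ 'n" where e: "norm e = 1" using norm_Basis nonempty_Basis by blast
  obtain c t1 where c: "0 < c" and t1: "0 < t1"
    and growth: "\<And>l t t0. l \<in> borel_measurable borel \<Longrightarrow>
      (\<And>s. 0 < s \<Longrightarrow> s \<le> t0 \<Longrightarrow> \<bar>l s\<bar> \<le> c / 2 * s powr \<kappa>) \<Longrightarrow> 0 < t \<Longrightarrow> t \<le> t0 \<Longrightarrow> t0 \<le> t1 \<Longrightarrow>
      c * t powr \<kappa> \<le> max_drift \<gamma> \<beta> l t"
    using max_drift_growth[OF \<gamma>1 \<beta>(1,2) \<kappa>_def] by blast
  have levy: "levy_process T M F L"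
    using assms(7) by (simp add: rot_inv_stable_process_def)
  then have cadlag: "cadlag_on T (\<lambda>t. L t \<omega>)" if "\<omega> \<in> space M" for \<omega>
    using that by (simp add: levy_process_def)
  let ?X = "extremal_solution \<gamma> \<beta> e T L"
  have sol: "sde_solution T M F L 0 (ray_drift \<gamma> \<beta> e) (?X \<sigma>)" if "\<sigma> = 1 \<or> \<sigma> = - 1" for \<sigma>
    using levy
    by (intro sde_solution_extremal_solution[OF \<gamma>1 \<beta>(1) e assms(1) that assms(5) _ cadlag])
      (auto simp: levy_process_def)
  have "AE \<omega> in M. \<exists>t0. 0 < t0 \<and> t0 \<le> T \<and>
      (\<forall>s. 0 < s \<longrightarrow> s \<le> t0 \<longrightarrow> \<bar>e \<bullet> L s \<omega>\<bar> \<le> c / 2 * s powr \<kappa>)"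
    by (rule stable_small_time[OF assms(2,4,5,7,1) \<kappa> \<kappa>\<alpha>]) (use c in simp)
  then have differ: "AE \<omega> in M. \<not> (\<forall>t\<in>{0..T}. ?X 1 t \<omega> = ?X (- 1) t \<omega>)"
  proof (rule AE_mp, intro AE_I2 impI)
    fix \<omega>
    assume \<omega>: "\<omega> \<in> space M" and "\<exists>t0. 0 < t0 \<and> t0 \<le> T \<and>
      (\<forall>s. 0 < s \<longrightarrow> s \<le> t0 \<longrightarrow> \<bar>e \<bullet> L s \<omega>\<bar> \<le> c / 2 * s powr \<kappa>)"
    then obtain t0 where t0: "0 < t0" "t0 \<le> T"
      and small: "\<And>s. 0 < s \<Longrightarrow> s \<le> t0 \<Longrightarrow> \<bar>e \<bullet> L s \<omega>\<bar> \<le> c / 2 * s powr \<kappa>" by blast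
    \<comment> \<open>A time before both the path-dependent horizon of the small noise and the
      deterministic horizon of the barrier.\<close>
    define t where "t = min t0 t1"
    have t: "0 < t" "t \<le> t0" "t \<le> t1" using t0 t1 by (auto simp: t_def)
    \<comment> \<open>The smallness of the noise concerns its modulus, so the same time serves both
      signs.\<close>
    have bound: "c * t powr \<kappa> \<le> max_drift \<gamma> \<beta> (\<lambda>s. \<sigma> * (e \<bullet> L (max 0 (min s T)) \<omega>)) t"
      if \<sigma>: "\<sigma> = 1 \<or> \<sigma> = - 1" for \<sigma>
    proof (rule growth[OF _ _ t(1) order_refl t(3)])
      show "(\<lambda>s. \<sigma> * (e \<bullet> L (max 0 (min s T)) \<omega>)) \<in> borel_measurable borel"
        by (intro borel_measurable_right_continuous tendsto_intros
          cadlag_clamp_right_continuous[OF cadlag[OF \<omega>] assms(1)])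
      fix s assume s: "0 < s" "s \<le> t"
      then have "max 0 (min s T) = s" using t t0 by auto
      then show "\<bar>\<sigma> * (e \<bullet> L (max 0 (min s T)) \<omega>)\<bar> \<le> c / 2 * s powr \<kappa>"
        using small[of s] s t \<sigma> by (auto simp: abs_mult)
    qed
    have "0 < c * t powr \<kappa>" using c t by simp
    \<comment> \<open>Both drift parts are positive at \<open>t\<close>; after the reflection by
      \<sigma> they lie on opposite sides of 0, while the noise term is common.\<close>
    then have "max_drift \<gamma> \<beta> (\<lambda>s. 1 * (e \<bullet> L (max 0 (min s T)) \<omega>)) t
      \<noteq> - max_drift \<gamma> \<beta> (\<lambda>s. - 1 * (e \<bullet> L (max 0 (min s T)) \<omega>)) t"
      using bound[of 1] bound[of "- 1"] by simp
    moreover have "e \<noteq> 0" using e by auto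
    ultimately have "?X 1 t \<omega> \<noteq> ?X (- 1) t \<omega>"
      unfolding extremal_solution_def add_right_cancel scaleR_cancel_right by simp
    moreover have "t \<in> {0..T}" using t t0 by simp
    ultimately show "\<not> (\<forall>t\<in>{0..T}. ?X 1 t \<omega> = ?X (- 1) t \<omega>)" by blast
  qed
  have "\<not> indistinguishable_on T M (?X 1) (?X (- 1))"
    \<comment> \<open>The paths differ almost surely, and in a probability space a property and its
      negation cannot both hold almost surely.\<close>
    unfolding indistinguishable_on_def using AE_contr[OF _ differ] by blast
  moreover have "ray_drift \<gamma> \<beta> e \<in> Lp_holder T p \<beta>"
    using assms(10) by (intro ray_drift_in_Lp_holder[OF \<beta>(1,3) e assms(1) _ \<gamma>p]) simp
  ultimately show ?thesis using sol by blast
qed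

end
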